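(* Assume (A1)-(A6) (see context) hold on the local region $(\Omega,V)$, where $V\subset\mathbb{R}^{N\times d}$ is an open ball centred at $Y^*$, and that the iterates satisfy $\theta_k\in\Omega$ for all $k\ge0$ almost surely. Suppose $F$ is strongly convex on $V$ with constant $c_Y>0$, i.e. $F(Y')\ge F(Y)+\langle\nabla_YF(Y),Y'-Y\rangle+\frac{c_Y}{2}\|Y'-Y\|_{\mathrm F}^2$ for all $Y,Y'\in V$, where $Y^*$ is the minimum point of $F$. Let $$\mu=\sqrt{1-\tfrac{b}{N}}\in(0,1),\quad c_2=\tfrac12(LB_1^2+B_0B_2)B_1^2,\quad c_4=4B_1^2L(1+B_1^2L),\quad \nu=\frac{\mu}{1-c_4\eta},$$ $$c_5=4c_2+\frac{b}{2N}B_1^4+\frac{2b\,B_1^4B_3^2}{N\mu(1-\mu)(1-\nu)}.$$ If the fixed step size $\eta>0$ satisfies $$\eta<\min\left\{\frac{1}{c_4}\cdot\frac{b}{2N},\ \frac{\sqrt{2\mu(1-\mu)}\,b}{8B_1^2B_3(2N-b)},\ 1,\ \frac{b}{c_5N}\lambda_{\min}\right\},$$ then there exist constants $C>0$ and $\rho\in(0,1)$ such that for all $k\ge0$ $$\mathbb{E}[F(Y(\theta_k))]-F(Y^* )\le C\rho^k,$$ where the expectation is over the batches $\mathcal B_0,\dots,\mathcal B_{k-1}$.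
   Context: Setting. $N,d,s\ge1$ are integers; $Y:\mathbb{R}^s\to\mathbb{R}^{N\times d}$ is $C^2$ (its $n$-th row $Y_n(\theta)$ is the output on sample $n$) and $F:\mathbb{R}^{N\times d}\to\mathbb{R}$ is $C^1$. $\nabla_YF(Y)\in\mathbb{R}^{N\times d}$ is the gradient. $\nabla_\theta Y_n(\theta)\in\mathbb{R}^{d\times s}$ is the Jacobian of $Y_n$, and $\nabla_\theta Y(\theta)\in\mathbb{R}^{Nd\times s}$ is the vertical concatenation of the $\nabla_\theta Y_n(\theta)$. $\nabla_\theta^2Y$ is the tensor of second derivatives. $\|\cdot\|_{\mathrm F}$ is the Frobenius norm (Euclidean norm of all entries). Surrogate output-gradient. $\widetilde{\nabla_YF}:\mathbb{R}^{N\times d}\times\mathbb{R}^{N\times d}\to\mathbb{R}^{N\times d}$, $(\tilde Y,Y)\mapsto\widetilde{\nabla_YF}(\tilde Y,Y)$, is $C^1$ in its first argument and satisfies $\widetilde{\nabla_YF}(Y,Y)=\nabla_YF(Y)$. For fixed $Y$, $\mathcal T(\Theta)$ denotes the derivative of $\tilde Y\mapsto\widetilde{\nabla_YF}(\tilde Y,Y)$ at $\tilde Y=\Theta$, a linear map $\Delta\mapsto\mathcal T(\Theta)[\Delta]$ on $\mathbb{R}^{N\times d}$. Algorithm (cached surrogate gradient). Start from a deterministic $\theta_0\in\mathbb{R}^s$ and cache $\tilde Y(\theta_0)=Y(\theta_0)$. At each step $k$ a random batch $\mathcal B_k\subset\{1,\dots,N\}$ of fixed size $b=|\mathcal B_k|$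 (with $1\le b<N$) is drawn, independently of the past, with every index belonging to $\mathcal B_k$ with probability $b/N$. Set $H_k=\sum_{n\in\mathcal B_k}\big(\widetilde{\nabla_YF}(\tilde Y(\theta_k),Y(\theta_k))\big)_n\nabla_\theta Y_n(\theta_k)\in\mathbb{R}^{1\times s}$ (subscript $n$: $n$-th row), $\theta_{k+1}=\theta_k-\eta H_k^\top$ with fixed step size $\eta>0$, and update the cache by rows: $\tilde Y(\theta_{k+1})_n=Y_n(\theta_{k+1})$ if $n\in\mathcal B_k$, and $\tilde Y(\theta_{k+1})_n=\tilde Y(\theta_k)_n$ if $n\notin\mathcal B_k$. Local region and assumptions. $\Omega\subset\mathbb{R}^s$ is an open convex set and $V\subset\mathbb{R}^{N\times d}$ is a convex set with $Y(\Omega)\subset V$. There are positive constants $B_0,L,B_1,B_2,\lambda_{\min},B_3$ such that: (A1) $\|\nabla_YF(Y)\|_{\mathrm F}\le B_0$ for $Y\in V$; (A2) $\|\nabla_YF(Y)-\nabla_YF(Y')\|_{\mathrm F}\le L\|Y-Y'\|_{\mathrm F}$ for $Y,Y'\in V$; (A3) $\|\nabla_\theta Y(\theta)\|_{\mathrm F}\le B_1$ for $\theta\in\Omega$; (A4) $\|\nabla_\theta^2Y(\theta)\|_{\mathrm F}\le B_2$ for $\theta\in\Omega$; (A5) the smallest eigenvalue of $\nabla_\theta Y(\theta)\nabla_\theta Y(\theta)^\top\in\mathbb{R}^{Nd\times Nd}$ is at least $\lambda_{\min}>0$ for $\theta\in\Omega$; (A6) $\|\mathcal T(\Theta)[\Delta]\|_{\mathrm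 F}\le B_3\|\Delta\|_{\mathrm F}$ for all $\Delta\in\mathbb{R}^{N\times d}$ and all relevant $\Theta$, i.e. (almost surely, for every $k$, with $Y=Y(\theta_k)$) all $\Theta=Y(\theta_k)+t(\tilde Y(\theta_k)-Y(\theta_k))$, $t\in[0,1]$. *)

theory Defs
  imports "HOL-Probability.Probability"
begin

text \<open>
  An \<open>N \<times> d\<close> matrix is an element of \<^typ>\<open>real^'d^'n\<close>, with \<open>N = CARD('n)\<close>, \<open>d = CARD('d)\<close>, and
  \<open>s = CARD('s)\<close>; its rows are \<open>y $ n\<close>. On nested \<open>vec\<close> types the library's \<^const>\<open>norm\<close> is the
  Euclidean norm of all entries, i.e. the Frobenius norm, and \<^const>\<open>inner\<close> the corresponding
  (Frobenius) inner product. This applies to the second derivative tensor below as well.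
\<close>

definition C1_map :: "('a::real_normed_vector \<Rightarrow> 'b::real_normed_vector) \<Rightarrow> bool" where
  "C1_map f \<longleftrightarrow>
    (\<exists>f' :: 'a \<Rightarrow> 'a \<Rightarrow>\<^sub>L 'b.
      (\<forall>x. (f has_derivative blinfun_apply (f' x)) (at x)) \<and> continuous_on UNIV f')"

definition C2_map :: "('a::real_normed_vector \<Rightarrow> 'b::real_normed_vector) \<Rightarrow> bool" where
  "C2_map f \<longleftrightarrow>
    (\<exists>f' :: 'a \<Rightarrow> 'a \<Rightarrow>\<^sub>L 'b.
      (\<forall>x. (f has_derivative blinfun_apply (f' x)) (at x)) \<and> C1_map f')"

text \<open>Meaningful only where \<open>f\<close> is differentiable.\<close>

definition gradient :: "('a::real_inner \<Rightarrow> real) \<Rightarrow> 'a \<Rightarrow> 'a" where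
  "gradient f x = (THE D. GDERIV f x :> D)"

definition row_jacobian :: "(real^'s \<Rightarrow> real^'d^'n) \<Rightarrow> 'n \<Rightarrow> real^'s \<Rightarrow> real^'s^'d" where
  "row_jacobian Y n \<theta> = jacobian (\<lambda>x. Y x $ n) (at \<theta>)"

text \<open>Vertical concatenation of the row Jacobians: the \<open>N d\<close> rows are indexed by pairs \<open>(n, i)\<close>.\<close>

definition full_jacobian ::
    "(real^'s \<Rightarrow> real^'d^'n) \<Rightarrow> real^'s \<Rightarrow> real^'s^('n::finite \<times> 'd::finite)" where
  "full_jacobian Y \<theta> = (\<chi> p. row_jacobian Y (fst p) \<theta> $ snd p)"

text \<open>
  The entry \<open>second_derivative Y \<theta> $ (n, i) $ j $ l\<close> is the derivative, in direction \<open>l\<close>, of the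
  partial derivative of \<open>Y\<^sub>n\<^sub>,\<^sub>i\<close> in direction \<open>j\<close>.
\<close>

definition second_derivative ::
    "(real^'s \<Rightarrow> real^'d^'n) \<Rightarrow> real^'s \<Rightarrow> real^'s^'s^('n::finite \<times> 'd::finite)" where
  "second_derivative Y \<theta> = (\<chi> p. jacobian (\<lambda>x. full_jacobian Y x $ p) (at \<theta>))"

definition is_eigenvalue :: "real^'m^'m \<Rightarrow> real \<Rightarrow> bool" where
  "is_eigenvalue A c \<longleftrightarrow> (\<exists>v. v \<noteq> 0 \<and> A *v v = c *\<^sub>R v)"

text \<open>
  To be used for symmetric \<open>A\<close> only: then the set of real eigenvalues is finite and nonempty, so
  that \<^const>\<open>Min\<close> is the genuine minimum.
\<close>

definition smallest_eigenvalue :: "real^'m^'m \<Rightarrow> real" where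
  "smallest_eigenvalue A = Min {c. is_eigenvalue A c}"

definition strongly_convex_on ::
    "'a::real_inner set \<Rightarrow> ('a \<Rightarrow> real) \<Rightarrow> real \<Rightarrow> bool" where
  "strongly_convex_on V F c \<longleftrightarrow>
    (\<forall>y\<in>V. \<forall>y'\<in>V. F y' \<ge> F y + inner (gradient F y) (y' - y) + c / 2 * (norm (y' - y))\<^sup>2)"

text \<open>
  In the next definitions, \<open>G\<close> is the surrogate output-gradient, with arguments in the order
  (cached output, true output), \<open>c\<close> is the cached output and \<open>\<B>\<close> the batch.
\<close>

definition batch_gradient ::
    "(real^'s \<Rightarrow> real^'d^'n) \<Rightarrow> (real^'d^'n \<Rightarrow> real^'d^'n \<Rightarrow> real^'d^'n) \<Rightarrow>
      real^'s \<Rightarrow> real^'d^'n \<Rightarrow> 'n set \<Rightarrow> real^'s" where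
  "batch_gradient Y G \<theta> c \<B> = (\<Sum>n\<in>\<B>. G c (Y \<theta>) $ n v* row_jacobian Y n \<theta>)"

text \<open>The state of the algorithm after \<open>k\<close> steps: parameter and cache.\<close>

primrec csg_state ::
    "(real^'s \<Rightarrow> real^'d^'n) \<Rightarrow> (real^'d^'n \<Rightarrow> real^'d^'n \<Rightarrow> real^'d^'n) \<Rightarrow>
      real \<Rightarrow> real^'s \<Rightarrow> (nat \<Rightarrow> 'n set) \<Rightarrow> nat \<Rightarrow> (real^'s) \<times> (real^'d^'n)" where
  "csg_state Y G \<eta> \<theta>\<^sub>0 \<B> 0 = (\<theta>\<^sub>0, Y \<theta>\<^sub>0)"
| "csg_state Y G \<eta> \<theta>\<^sub>0 \<B> (Suc k) =
    (let (\<theta>, c) = csg_state Y G \<eta> \<theta>\<^sub>0 \<B> k;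
         \<theta>' = \<theta> - \<eta> *\<^sub>R batch_gradient Y G \<theta> c (\<B> k)
     in (\<theta>', \<chi> n. if n \<in> \<B> k then Y \<theta>' $ n else c $ n))"

definition csg_param ::
    "(real^'s \<Rightarrow> real^'d^'n) \<Rightarrow> (real^'d^'n \<Rightarrow> real^'d^'n \<Rightarrow> real^'d^'n) \<Rightarrow>
      real \<Rightarrow> real^'s \<Rightarrow> (nat \<Rightarrow> 'n set) \<Rightarrow> nat \<Rightarrow> real^'s" where
  "csg_param Y G \<eta> \<theta>\<^sub>0 \<B> k = fst (csg_state Y G \<eta> \<theta>\<^sub>0 \<B> k)"

definition csg_cache ::
    "(real^'s \<Rightarrow> real^'d^'n) \<Rightarrow> (real^'d^'n \<Rightarrow> real^'d^'n \<Rightarrow> real^'d^'n) \<Rightarrow>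
      real \<Rightarrow> real^'s \<Rightarrow> (nat \<Rightarrow> 'n set) \<Rightarrow> nat \<Rightarrow> real^'d^'n" where
  "csg_cache Y G \<eta> \<theta>\<^sub>0 \<B> k = snd (csg_state Y G \<eta> \<theta>\<^sub>0 \<B> k)"

text \<open>
  As the starting point is deterministic, the past at step \<open>k\<close> is generated by the batches before
  \<open>k\<close>; hence independence of each batch of the past is mutual independence of the family. The laws
  of the individual batches may differ.
\<close>

definition random_batches :: "'w measure \<Rightarrow> nat \<Rightarrow> (nat \<Rightarrow> 'w \<Rightarrow> 'n::finite set) \<Rightarrow> bool" where
  "random_batches M b \<B> \<longleftrightarrow>
    prob_space M \<and>
    prob_space.indep_vars M (\<lambda>_. count_space UNIV) \<B> UNIV \<and>
    (\<forall>k. \<forall>\<omega>\<in>space M. card (\<B> k \<omega>) = b) \<and>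
    (\<forall>k n. measure M {\<omega> \<in> space M. n \<in> \<B> k \<omega>} = real b / real CARD('n))"

end

(*
  Write d for the cache error c - Y theta, q = b/N and mu^2 = 1 - q. The Lyapunov function
  W = F(Y theta) - F(Ystar) + kappa |d|^2, with kappa = q B3^2 (1 + 4 c2 eta^2) / (1 - mu), contracts
  in conditional expectation. The smooth descent inequality for F o Y leaves an error of the order of
  |grad F| |d| and |d|^2. A row of d survives a step with probability 1 - q, so Young's inequality
  with weight mu contracts the expectation of |d|^2 by mu, up to the drift of Y, which is of order
  eta^2 |grad F|^2 + eta^2 |d|^2. The step size bounds make all these terms smaller than the decrease
  eta q lambda |grad F|^2, and strong convexity bounds |grad F|^2 from below by F - F(Ystar).

  A batch sequence takes finitely many values up to time k, so expectations are finite sums over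
  histories, and an almost sure property holds for each history of positive probability.
*)
theory Submission
  imports Defs
begin

text \<open>The obstacle is that a step uses the stale p = G c (Y theta) in place of g = grad F (Y
  theta), so the loss alone need not decrease. (A6) bounds the derivative of G along the segment
  from Y theta to c only, which is just enough for |p - g| <= B3 |d|; hence loss and cache error
  have to be controlled together. Given the past, p and d are fixed and only the batch S is random.
  The step applies the transposed Jacobian to \<open>mask S p\<close>, and the old cache error that
  survives is \<open>mask (- S) d\<close>, so linear and squared-norm expressions in them average to
  multiples of the unmasked ones. (A5) enters as lambda |g|^2 <= |J^T g|^2 with J the full Jacobian;
  as the smallest eigenvalue is a minimum over eigenvalues, this rests on the Rayleigh principle.
  The cross term <J^T g, J^T (p - g)> is split so that its g part has order eta^2, like the other
  errors collected in c5. What remains for |g|^2 is the decrease eta (q lambda - eta c5), positive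
  by the last bound on eta.\<close>

subsection \<open>Smallest eigenvalue of a symmetric matrix\<close>

text \<open>The entries may be numbers or vectors and those of \<open>T\<close> vectors or matrices:
  this compares Frobenius and operator bounds once for the rows of a matrix and once for the matrix
  slices of the second derivative tensor.\<close>

lemma norm_vec_le_scaled:
  fixes f :: "'m::finite \<Rightarrow> 'a::real_normed_vector" and T :: "'b::real_normed_vector^'m"
  assumes "\<And>i. norm (f i) \<le> norm (T $ i) * c"
  shows "norm (\<chi> i. f i) \<le> norm T * c"
proof -
  \<comment> \<open>The sign of \<open>c\<close> is not given, but a nonzero entry of
    \<open>T\<close> forces it; scaling inside \<open>L2_set\<close> relies on it.\<close>
  have c: "0 \<le> c" if "T \<noteq> 0"
  proof -
    have "\<exists>i. T $ i \<noteq> 0" using that by (simp add: vec_eq_iff)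
    then obtain i where "T $ i \<noteq> 0" by blast
    moreover have "0 \<le> norm (T $ i) * c" using assms[of i] norm_ge_zero order_trans by blast
    ultimately show ?thesis by (simp add: zero_le_mult_iff)
  qed
  show ?thesis
  proof (cases "T = 0")
    case True
    then have "f i = 0" for i using assms[of i] by simp
    then have "(\<chi> i. f i) = 0" by (simp add: vec_eq_iff)
    then show ?thesis using True by simp
  next
    case False
    have "L2_set (\<lambda>i. norm (f i)) UNIV \<le> L2_set (\<lambda>i. norm (T $ i) * c) UNIV"
      by (rule L2_set_mono) (use assms in auto)
    also have "\<dots> = L2_set (\<lambda>i. norm (T $ i)) UNIV * c"
      using c[OF False] by (simp add: L2_set_left_distrib)
    finally show ?thesis by (simp add: norm_vec_def)
  qed
qed

lemma norm_matrix_vector_mult_le_frobenius: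
  fixes A :: "real^'m^'n"
  shows "norm (A *v x) \<le> norm A * norm x"
proof -
  have "norm ((A *v x) $ i) \<le> norm (A $ i) * norm x" for i
    using Cauchy_Schwarz_ineq2[of "A $ i" x] by (simp add: matrix_vector_mul_component)
  then have "norm (\<chi> i. (A *v x) $ i) \<le> norm A * norm x" by (rule norm_vec_le_scaled)
  then show ?thesis by simp
qed

text \<open>First variation: moving \<open>u\<close> along the residual \<open>w\<close> of the
  eigenvalue equation changes the form by \<open>2 * t * (norm w)\<^sup>2\<close> to first order,
  which would be negative for small negative \<open>t\<close> unless \<open>w\<close>
  vanishes.\<close>

lemma rayleigh_minimizer_eigenvector:
  fixes A :: "real^'m^'m"
  assumes sym: "transpose A = A" and u: "norm u = 1"
    and min: "\<And>v. m * (norm v)\<^sup>2 \<le> v \<bullet> (A *v v)" and att: "u \<bullet> (A *v u) = m"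
  shows "A *v u = m *\<^sub>R u"
proof -
  define w where "w = A *v u - m *\<^sub>R u"
  have uw: "w \<bullet> (A *v u) = u \<bullet> (A *v w)"
    by (metis sym dot_lmul_matrix inner_commute matrix_transpose_mul transpose_matrix_vector vector_transpose_matrix)
  define K where "K = w \<bullet> (A *v w) - m * (norm w)\<^sup>2"
  have K0: "K \<ge> 0" unfolding K_def using min[of w] by simp
  have quad: "0 \<le> 2 * t * (norm w)\<^sup>2 + t\<^sup>2 * K" for t
  proof -
    have "m * (norm (u + t *\<^sub>R w))\<^sup>2 \<le> (u + t *\<^sub>R w) \<bullet> (A *v (u + t *\<^sub>R w))" by (rule min)
    also have "A *v (u + t *\<^sub>R w) = A *v u + t *\<^sub>R (A *v w)"
      by (simp add: matrix_vector_right_distrib matrix_vector_mult_scaleR)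
    finally have "m * ((u + t *\<^sub>R w) \<bullet> (u + t *\<^sub>R w)) \<le> (u + t *\<^sub>R w) \<bullet> (A *v u + t *\<^sub>R (A *v w))"
      by (simp add: power2_norm_eq_inner)
    moreover have "u \<bullet> u = 1" using u by (simp add: norm_eq_1)
    ultimately have "0 \<le> 2 * t * (w \<bullet> (A *v u) - m * (u \<bullet> w)) + t\<^sup>2 * K"
      using att uw by (simp add: inner_add_left inner_add_right algebra_simps K_def
          power2_norm_eq_inner[unfolded power2_eq_square] power2_eq_square inner_commute[of w u])
    moreover have "w \<bullet> (A *v u) - m * (u \<bullet> w) = (norm w)\<^sup>2"
      by (simp add: power2_norm_eq_inner w_def inner_diff_right inner_diff_left algebra_simps inner_commute)
    ultimately show ?thesis by simp
  qed
  have "norm w = 0"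
  proof (rule ccontr)
    assume "norm w \<noteq> 0"
    then have W: "(norm w)\<^sup>2 > 0" by simp
    \<comment> \<open>The quadratic in \<open>t\<close> is minimal at
      \<open>- (norm w)\<^sup>2 / K\<close>; the denominator \<open>K + 1\<close> also covers
      \<open>K = 0\<close>.\<close>
    define t where "t = - (norm w)\<^sup>2 / (K + 1)"
    have "2 * t * (norm w)\<^sup>2 + t\<^sup>2 * K = ((norm w)\<^sup>2)\<^sup>2 / (K + 1) * (K / (K + 1) - 2)"
      by (simp add: t_def power_divide power2_eq_square[of "K + 1"] power2_eq_square[of "(norm w)\<^sup>2"] right_diff_distrib)
    moreover have "K / (K + 1) - 2 < 0" using K0 by (simp add: field_simps)
    moreover have "((norm w)\<^sup>2)\<^sup>2 / (K + 1) > 0" using W K0 by simp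
    ultimately have "2 * t * (norm w)\<^sup>2 + t\<^sup>2 * K < 0" by (metis mult_pos_neg)
    then show False using quad[of t] by linarith
  qed
  then show ?thesis by (simp add: w_def)
qed

text \<open>One eigenvector chosen per eigenvalue gives an injective family of pairwise orthogonal
  nonzero vectors, hence an independent set in finite dimension. \<open>Min_le\<close> depends on
  this finiteness.\<close>

lemma finite_eigenvalues_symmetric:
  fixes A :: "real^'m^'m"
  assumes sym: "transpose A = A"
  shows "finite {c. is_eigenvalue A c}"
proof -
  define e where "e c = (SOME v. v \<noteq> 0 \<and> A *v v = c *\<^sub>R v)" for c
  have e: "e c \<noteq> 0 \<and> A *v e c = c *\<^sub>R e c" if "is_eigenvalue A c" for c
    unfolding e_def by (rule someI_ex) (use that in \<open>simp add: is_eigenvalue_def\<close>)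
  have orth: "e c \<bullet> e c' = 0" if "is_eigenvalue A c" "is_eigenvalue A c'" "c \<noteq> c'" for c c'
  proof -
    have "e c \<bullet> (A *v e c') = (A *v e c) \<bullet> e c'"
      by (metis sym dot_lmul_matrix vector_transpose_matrix transpose_matrix_vector)
    then have "c' * (e c \<bullet> e c') = c * (e c \<bullet> e c')" using e that by simp
    then show ?thesis using that by simp
  qed
  have inj: "inj_on e {c. is_eigenvalue A c}"
    by (intro inj_onI) (metis e inner_eq_zero_iff mem_Collect_eq orth)
  have "pairwise orthogonal (e ` {c. is_eigenvalue A c})"
    unfolding pairwise_def orthogonal_def using orth by (metis (no_types, lifting) imageE mem_Collect_eq)
  moreover have "0 \<notin> e ` {c. is_eigenvalue A c}" using e by force
  ultimately have "independent (e ` {c. is_eigenvalue A c})"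
    by (rule pairwise_orthogonal_independent)
  then have "finite (e ` {c. is_eigenvalue A c})" using independent_bound by blast
  then show ?thesis using inj finite_imageD by blast
qed

text \<open>By compactness the form attains its minimum \<open>m\<close> on the unit sphere; the
  minimizer is an eigenvector for \<open>m\<close>, so the least eigenvalue cannot exceed
  \<open>m\<close>.\<close>

lemma smallest_eigenvalue_le_rayleigh:
  fixes A :: "real^'m^'m"
  assumes sym: "transpose A = A"
  shows "smallest_eigenvalue A * (norm v)\<^sup>2 \<le> v \<bullet> (A *v v)"
proof -
  have "continuous_on (sphere 0 1) (\<lambda>u. u \<bullet> (A *v u))"
    by (intro continuous_on_inner continuous_on_id linear_continuous_on matrix_vector_mul_bounded_linear)
  then have "\<exists>u\<in>sphere 0 1. \<forall>v\<in>sphere 0 1. u \<bullet> (A *v u) \<le> v \<bullet> (A *v v)"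
    by (intro continuous_attains_inf) auto
  then obtain u where u: "norm u = 1" and least: "\<And>v. norm v = 1 \<Longrightarrow> u \<bullet> (A *v u) \<le> v \<bullet> (A *v v)"
    by auto
  define m where "m = u \<bullet> (A *v u)"
  have min: "m * (norm v)\<^sup>2 \<le> v \<bullet> (A *v v)" for v
  proof (cases "v = 0")
    case False
    have "m \<le> (v /\<^sub>R norm v) \<bullet> (A *v (v /\<^sub>R norm v))"
      unfolding m_def by (rule least) (use False in simp)
    also have "\<dots> = v \<bullet> (A *v v) / (norm v)\<^sup>2"
      by (simp add: matrix_vector_mult_scaleR power2_eq_square divide_inverse)
    finally show ?thesis using False by (simp add: field_simps)
  qed simp
  have "A *v u = m *\<^sub>R u"
    using rayleigh_minimizer_eigenvector[OF sym u min] m_def by simp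
  then have "is_eigenvalue A m" unfolding is_eigenvalue_def using u by (intro exI[of _ u]) auto
  then have "smallest_eigenvalue A \<le> m"
    unfolding smallest_eigenvalue_def by (intro Min_le finite_eigenvalues_symmetric sym) simp
  then have "smallest_eigenvalue A * (norm v)\<^sup>2 \<le> m * (norm v)\<^sup>2" by (rule mult_right_mono) simp
  then show ?thesis using min[of v] by linarith
qed

subsection \<open>Output derivative and its adjoint\<close>

lemma has_derivative_vec_lambdaI:
  fixes f :: "'a::real_normed_vector \<Rightarrow> 'b::euclidean_space^'n"
  assumes "\<And>i. ((\<lambda>x. f x $ i) has_derivative (\<lambda>h. f' h $ i)) (at x)"
  shows "(f has_derivative f') (at x)"
proof -
  have "((\<lambda>x. f x \<bullet> e) has_derivative (\<lambda>h. f' h \<bullet> e)) (at x)" if e: "e \<in> Basis" for e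
  proof -
    obtain i u where "e = axis i u" using e unfolding Basis_vec_def by blast
    then show ?thesis using has_derivative_inner_left[OF assms[of i], of u] by (simp add: inner_axis)
  qed
  then show ?thesis
    using has_derivative_componentwise_within[of f f' x UNIV] by blast
qed

text \<open>The Riesz representative of \<open>f'\<close> is \<open>adjoint f' 1\<close>, and
  uniqueness of derivatives identifies it with the description in \<open>gradient\<close>.\<close>

lemma has_derivative_gradient:
  fixes f :: "'a::euclidean_space \<Rightarrow> real"
  assumes "(f has_derivative f') (at x)"
  shows "(f has_derivative (\<lambda>h. gradient f x \<bullet> h)) (at x)"
proof -
  have "(\<lambda>h. h \<bullet> adjoint f' 1) = f'"
    using adjoint_works[OF has_derivative_linear[OF assms], of _ 1] by auto
  then have D: "GDERIV f x :> adjoint f' 1"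
    using assms unfolding gderiv_def by (simp only:)
  have "D' = adjoint f' 1" if "GDERIV f x :> D'" for D'
  proof -
    have "(\<lambda>h. h \<bullet> D') = (\<lambda>h. h \<bullet> adjoint f' 1)"
      using that D unfolding gderiv_def by (rule has_derivative_unique)
    then show ?thesis by (metis vector_eq_ldot)
  qed
  then have "gradient f x = adjoint f' 1"
    unfolding gradient_def using D by (rule the_equality[rotated])
  then show ?thesis using D unfolding gderiv_def by (simp add: inner_commute)
qed

text \<open>The derivative of \<open>Y\<close> with values in matrices, where \<open>F\<close> and
  \<open>G\<close> live. (A3) to (A5) concern \<open>full_jacobian\<close>, which indexes by pairs;
  the isometry \<open>flatten\<close> translates between the two shapes.\<close>

definition output_derivative ::
    "(real^'s \<Rightarrow> real^'d^'n) \<Rightarrow> real^'s \<Rightarrow> real^'s \<Rightarrow> real^'d^'n" where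
  "output_derivative Y \<theta> h = (\<chi> n. row_jacobian Y n \<theta> *v h)"

definition flatten :: "real^'d^'n \<Rightarrow> real^('n::finite \<times> 'd::finite)" where
  "flatten p = (\<chi> q. p $ fst q $ snd q)"

lemma inner_flatten: "flatten p \<bullet> flatten p' = p \<bullet> p'"
  unfolding inner_vec_def flatten_def
  by (simp add: sum.cartesian_product UNIV_Times_UNIV[symmetric] case_prod_beta del: UNIV_Times_UNIV)

lemma norm_flatten [simp]: "norm (flatten p) = norm p"
  by (simp add: norm_eq_sqrt_inner inner_flatten)

lemma flatten_diff: "flatten (p - p') = flatten p - flatten p'"
  by (simp add: flatten_def vec_eq_iff)

lemma full_jacobian_mult: "full_jacobian Y \<theta> *v h = flatten (output_derivative Y \<theta> h)"
  by (simp add: full_jacobian_def flatten_def output_derivative_def vec_eq_iff matrix_vector_mul_component)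

lemma norm_output_derivative_le:
  "norm (output_derivative Y \<theta> h) \<le> norm (full_jacobian Y \<theta>) * norm h"
  using norm_matrix_vector_mult_le_frobenius[of "full_jacobian Y \<theta>" h] by (simp add: full_jacobian_mult)

lemma norm_output_derivative_diff_le:
  "norm (output_derivative Y \<theta> h - output_derivative Y \<theta>' h)
     \<le> norm (full_jacobian Y \<theta> - full_jacobian Y \<theta>') * norm h"
  using norm_matrix_vector_mult_le_frobenius[of "full_jacobian Y \<theta> - full_jacobian Y \<theta>'" h]
  by (simp add: full_jacobian_mult matrix_vector_mult_diff_rdistrib flatten_diff[symmetric])

text \<open>The transposed Jacobian applied to a matrix, written as a sum over samples so that
  restricting it to a batch amounts to masking \<open>p\<close>.\<close>

definition output_adjoint ::
    "(real^'s \<Rightarrow> real^'d^'n) \<Rightarrow> real^'s \<Rightarrow> real^'d^'n \<Rightarrow> real^'s" where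
  "output_adjoint Y \<theta> p = (\<Sum>n\<in>UNIV. p $ n v* row_jacobian Y n \<theta>)"

lemma output_adjoint_inner: "output_adjoint Y \<theta> p \<bullet> h = p \<bullet> output_derivative Y \<theta> h"
  by (simp add: output_adjoint_def output_derivative_def inner_sum_left dot_lmul_matrix inner_vec_def[of p])

lemma output_adjoint_eq: "output_adjoint Y \<theta> p = transpose (full_jacobian Y \<theta>) *v flatten p"
proof -
  have "output_adjoint Y \<theta> p \<bullet> h = (transpose (full_jacobian Y \<theta>) *v flatten p) \<bullet> h" for h
    by (simp add: output_adjoint_inner dot_lmul_matrix full_jacobian_mult inner_flatten)
  then show ?thesis by (metis vector_eq_rdot)
qed

lemma linear_output_adjoint: "linear (output_adjoint Y \<theta>)"
  by (rule linearI) (simp_all add: output_adjoint_def vec.scale_sum_right vector_add_component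
      vector_scaleR_component sum.distrib scaleR_sum_right vector_matrix_left_distrib scaleR_vector_matrix_assoc)

text \<open>Duality: pair the adjoint image with itself, use the bound for
  \<open>output_derivative\<close>, and cancel one factor of its norm.\<close>

lemma norm_output_adjoint_le:
  "norm (output_adjoint Y \<theta> p) \<le> norm (full_jacobian Y \<theta>) * norm p"
proof -
  let ?z = "output_adjoint Y \<theta> p"
  have "norm ?z * norm ?z = p \<bullet> output_derivative Y \<theta> ?z"
    by (simp add: output_adjoint_inner[symmetric] power2_norm_eq_inner[symmetric] power2_eq_square[symmetric])
  also have "\<dots> \<le> norm p * norm (output_derivative Y \<theta> ?z)" by (rule norm_cauchy_schwarz)
  also have "\<dots> \<le> norm p * (norm (full_jacobian Y \<theta>) * norm ?z)"
    by (intro mult_left_mono norm_output_derivative_le) simp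
  finally have "norm ?z * norm ?z \<le> (norm (full_jacobian Y \<theta>) * norm p) * norm ?z"
    by (simp add: mult_ac)
  then show ?thesis
    by (cases "norm ?z = 0") (auto simp: mult_le_cancel_right)
qed

text \<open>The quadratic form of J J^T at p is |J^T p|^2. At the output gradient this bounds the
  parameter gradient of the loss from below.\<close>

lemma smallest_eigenvalue_le_output_adjoint:
  "smallest_eigenvalue (full_jacobian Y \<theta> ** transpose (full_jacobian Y \<theta>)) * (norm p)\<^sup>2
     \<le> (norm (output_adjoint Y \<theta> p))\<^sup>2"
proof -
  let ?J = "full_jacobian Y \<theta>"
  have "smallest_eigenvalue (?J ** transpose ?J) * (norm (flatten p))\<^sup>2
      \<le> flatten p \<bullet> ((?J ** transpose ?J) *v flatten p)"
    by (rule smallest_eigenvalue_le_rayleigh) (simp add: matrix_transpose_mul transpose_transpose)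
  also have "\<dots> = (norm (output_adjoint Y \<theta> p))\<^sup>2"
    by (simp add: output_adjoint_eq power2_norm_eq_inner matrix_vector_mul_assoc[symmetric]
        dot_lmul_matrix[symmetric] del: matrix_vector_mul_assoc)
  finally show ?thesis by simp
qed

lemma batch_gradient_eq_output_adjoint:
  "batch_gradient Y G \<theta> c S = output_adjoint Y \<theta> (\<chi> n. if n \<in> S then G c (Y \<theta>) $ n else 0)"
  unfolding batch_gradient_def output_adjoint_def
  by (rule sum.mono_neutral_cong_left) auto

section \<open>Derivatives and Lipschitz bounds of a twice continuously differentiable output
  map\<close>

context
  fixes Y :: "real^'s \<Rightarrow> real^'d^'n"
  assumes Y: "C2_map Y"
begin

lemma C2_map_has_derivative_output: "(Y has_derivative output_derivative Y \<theta>) (at \<theta>)"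
proof -
  obtain Y' where Y': "\<And>x. (Y has_derivative blinfun_apply (Y' x)) (at x)"
    using Y unfolding C2_map_def by blast
  have "((\<lambda>x. Y x $ n) has_derivative (\<lambda>h. blinfun_apply (Y' \<theta>) h $ n)) (at \<theta>)" for n
    by (rule bounded_linear.has_derivative[OF bounded_linear_vec_nth Y'])
  then have "(\<lambda>x. Y x $ n) differentiable at \<theta>" for n
    by (rule differentiableI)
  then have "((\<lambda>x. Y x $ n) has_derivative (\<lambda>h. row_jacobian Y n \<theta> *v h)) (at \<theta>)" for n
    unfolding row_jacobian_def by (simp only: jacobian_works)
  then show ?thesis
    by (simp add: has_derivative_vec_lambdaI output_derivative_def)
qed

text \<open>\<open>C2_map\<close> provides a derivative of an operator-valued map. A Jacobian entry
  is this operator evaluated at a coordinate vector and then at a pair of indices, which is bounded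
  linear, so differentiability passes to the entries.\<close>

lemma C2_map_has_derivative_full_jacobian:
  "(full_jacobian Y has_derivative (\<lambda>h. \<chi> p. second_derivative Y \<theta> $ p *v h)) (at \<theta>)"
proof -
  obtain Y' where Y': "\<And>x. (Y has_derivative blinfun_apply (Y' x)) (at x)" and C1: "C1_map Y'"
    using Y unfolding C2_map_def by blast
  obtain Y'' where Y'': "\<And>x. (Y' has_derivative blinfun_apply (Y'' x)) (at x)"
    using C1 unfolding C1_map_def by blast
  have eq: "blinfun_apply (Y' x) = output_derivative Y x" for x
    using has_derivative_unique[OF Y' C2_map_has_derivative_output] .
  have entry: "full_jacobian Y x $ p $ j = blinfun_apply (Y' x) (axis j 1) $ fst p $ snd p" for x p j
    unfolding eq by (simp add: full_jacobian_def output_derivative_def matrix_vector_mul_component inner_axis)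
  have "(\<lambda>x. full_jacobian Y x $ p) differentiable at \<theta>" for p
  proof (rule differentiableI, rule has_derivative_vec_lambdaI)
    fix j
    have "((\<lambda>x. blinfun_apply (Y' x) (axis j 1) $ fst p $ snd p) has_derivative
        (\<lambda>h. blinfun_apply (blinfun_apply (Y'' \<theta>) h) (axis j 1) $ fst p $ snd p)) (at \<theta>)"
      by (intro bounded_linear.has_derivative[OF bounded_linear_vec_nth]
          bounded_linear.has_derivative[OF blinfun.bounded_linear_left] Y'')
    then show "((\<lambda>x. full_jacobian Y x $ p $ j) has_derivative
        (\<lambda>h. (\<chi> j. blinfun_apply (blinfun_apply (Y'' \<theta>) h) (axis j 1) $ fst p $ snd p) $ j)) (at \<theta>)"
      by (simp add: entry)
  qed
  then show ?thesis
    by (simp add: has_derivative_vec_lambdaI second_derivative_def jacobian_works)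
qed

lemma full_jacobian_Lipschitz:
  assumes "convex S" and "\<And>\<theta>. \<theta> \<in> S \<Longrightarrow> norm (second_derivative Y \<theta>) \<le> K"
    and "\<theta> \<in> S" "\<theta>' \<in> S"
  shows "norm (full_jacobian Y \<theta> - full_jacobian Y \<theta>') \<le> K * norm (\<theta> - \<theta>')"
proof (rule differentiable_bound[OF assms(1) _ _ assms(3,4)])
  fix x assume x: "x \<in> S"
  show "(full_jacobian Y has_derivative (\<lambda>h. \<chi> p. second_derivative Y x $ p *v h)) (at x within S)"
    using C2_map_has_derivative_full_jacobian by (rule has_derivative_at_withinI)
  have "norm (\<chi> p. second_derivative Y x $ p *v h) \<le> norm (second_derivative Y x) * norm h" for h
    by (rule norm_vec_le_scaled) (rule norm_matrix_vector_mult_le_frobenius)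
  then have "norm (\<chi> p. second_derivative Y x $ p *v h) \<le> K * norm h" for h
    by (meson assms(2) x mult_right_mono norm_ge_zero order_trans)
  then show "onorm (\<lambda>h. \<chi> p. second_derivative Y x $ p *v h) \<le> K"
    by (intro onorm_le)
qed

lemma output_Lipschitz:
  assumes "convex S" and "\<And>\<theta>. \<theta> \<in> S \<Longrightarrow> norm (full_jacobian Y \<theta>) \<le> K"
    and "\<theta> \<in> S" "\<theta>' \<in> S"
  shows "norm (Y \<theta> - Y \<theta>') \<le> K * norm (\<theta> - \<theta>')"
proof (rule differentiable_bound[OF assms(1) _ _ assms(3,4)])
  fix x assume x: "x \<in> S"
  show "(Y has_derivative output_derivative Y x) (at x within S)"
    using C2_map_has_derivative_output by (rule has_derivative_at_withinI)
  have "norm (output_derivative Y x h) \<le> K * norm h" for h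
    by (meson assms(2) x mult_right_mono norm_ge_zero norm_output_derivative_le order_trans)
  then show "onorm (output_derivative Y x) \<le> K" by (intro onorm_le)
qed

end

text \<open>Along the segment, subtract the first order term and the quadratic remainder; the
  Lipschitz condition makes the derivative of the difference nonpositive. Monotonicity thus takes
  the place of the integral form of the remainder.\<close>

lemma descent_inequality:
  fixes f :: "'a::real_normed_vector \<Rightarrow> real"
  assumes "convex S" and der: "\<And>x. x \<in> S \<Longrightarrow> (f has_derivative f' x) (at x)"
    and lip: "\<And>x y h. x \<in> S \<Longrightarrow> y \<in> S \<Longrightarrow> \<bar>f' x h - f' y h\<bar> \<le> K * norm (x - y) * norm h"
    and x: "x \<in> S" and y: "y \<in> S"
  shows "f y \<le> f x + f' x (y - x) + K / 2 * (norm (y - x))\<^sup>2"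
proof -
  define u where "u = y - x"
  define \<phi> where "\<phi> t = f (x + t *\<^sub>R u) - t * f' x u - K / 2 * t\<^sup>2 * (norm u)\<^sup>2" for t
  have "\<phi> 1 \<le> \<phi> 0"
  proof (rule DERIV_nonpos_imp_nonincreasing[of 0 1 \<phi>])
    fix t :: real assume t: "0 \<le> t" "t \<le> 1"
    have "x + t *\<^sub>R u = (1 - t) *\<^sub>R x + t *\<^sub>R y" by (simp add: u_def algebra_simps)
    then have inS: "x + t *\<^sub>R u \<in> S" using assms(1) x y t by (simp add: convexD_alt)
    have "((\<lambda>t. f (x + t *\<^sub>R u)) has_derivative (\<lambda>h. f' (x + t *\<^sub>R u) (h *\<^sub>R u))) (at t)"
    proof -
      have "((\<lambda>t. x + t *\<^sub>R u) has_derivative (\<lambda>h. h *\<^sub>R u)) (at t)"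
        by (auto intro!: derivative_eq_intros)
      from has_derivative_compose[OF this, of f] der[OF inS] show ?thesis by blast
    qed
    also have "(\<lambda>h. f' (x + t *\<^sub>R u) (h *\<^sub>R u)) = (*) (f' (x + t *\<^sub>R u) u)"
      using has_derivative_linear[OF der[OF inS]] by (simp add: fun_eq_iff linear_scale)
    finally have "DERIV (\<lambda>t. f (x + t *\<^sub>R u)) t :> f' (x + t *\<^sub>R u) u"
      by (simp add: has_field_derivative_def)
    then have "DERIV \<phi> t :> f' (x + t *\<^sub>R u) u - f' x u - K * t * (norm u)\<^sup>2"
      unfolding \<phi>_def by (auto intro!: derivative_eq_intros)
    moreover have "f' (x + t *\<^sub>R u) u - f' x u \<le> K * t * (norm u)\<^sup>2"
      using lip[OF inS x, of u] t by (simp add: power2_eq_square mult_ac)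
    ultimately show "\<exists>d. DERIV \<phi> t :> d \<and> d \<le> 0" by force
  qed simp
  then show ?thesis by (simp add: \<phi>_def u_def)
qed

subsection \<open>One step of the algorithm\<close>

definition mask :: "'n set \<Rightarrow> 'a::zero^'n \<Rightarrow> 'a^'n" where
  "mask S x = (\<chi> n. if n \<in> S then x $ n else 0)"

lemma norm_vec_squared: "(norm (x :: 'a::real_normed_vector^'n))\<^sup>2 = (\<Sum>n\<in>UNIV. (norm (x $ n))\<^sup>2)"
  by (simp add: norm_vec_def L2_set_def sum_nonneg)

lemma norm_mask_squared:
  "(norm (mask S (x :: 'a::real_normed_vector^'n)))\<^sup>2 = (\<Sum>n\<in>UNIV. of_bool (n \<in> S) * (norm (x $ n))\<^sup>2)"
  unfolding norm_vec_squared mask_def by (rule sum.cong) auto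

lemma norm_mask_le: "norm (mask S (x :: 'a::real_normed_vector^'n)) \<le> norm x"
  unfolding norm_vec_def mask_def by (rule L2_set_mono) auto

text \<open>Right side minus left side equals \<open>(norm ((1 - m) *\<^sub>R x + m *\<^sub>R
  y))\<^sup>2 / (m * (1 - m))\<close>.\<close>

lemma norm_diff_squared_le:
  fixes x y :: "'a::real_inner"
  assumes "0 < m" "m < 1"
  shows "(norm (x - y))\<^sup>2 \<le> (norm x)\<^sup>2 / m + (norm y)\<^sup>2 / (1 - m)"
proof -
  have "0 \<le> (norm ((1 - m) *\<^sub>R x + m *\<^sub>R y))\<^sup>2 / (m * (1 - m))" using assms by simp
  also have "(norm ((1 - m) *\<^sub>R x + m *\<^sub>R y))\<^sup>2
      = (1 - m)\<^sup>2 * (norm x)\<^sup>2 + 2 * (m * (1 - m)) * (x \<bullet> y) + m\<^sup>2 * (norm y)\<^sup>2"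
    unfolding power2_norm_eq_inner
    by (simp add: inner_add_left inner_add_right inner_commute[of y x] power2_eq_square algebra_simps)
  also have "\<dots> / (m * (1 - m)) = (1 - m) * (norm x)\<^sup>2 / m + 2 * (x \<bullet> y) + m * (norm y)\<^sup>2 / (1 - m)"
    using assms by (simp add: add_divide_distrib power2_eq_square)
  also have "\<dots> = (norm x)\<^sup>2 / m + (norm y)\<^sup>2 / (1 - m) - (norm (x - y))\<^sup>2"
    unfolding power2_norm_eq_inner
    using assms by (simp add: inner_diff_left inner_diff_right inner_commute[of y x] field_simps)
  finally show ?thesis by simp
qed

section \<open>Averages of masked vectors over a random batch\<close>

context
  fixes w :: "'n::finite set \<Rightarrow> real" and q :: real
  assumes w_incl: "\<And>n. (\<Sum>S\<in>UNIV. w S * of_bool (n \<in> S)) = q"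
begin

text \<open>A squared norm is a sum over rows; after exchanging the sums, each row carries the total
  weight of the batches that contain it, which is \<open>q\<close>. The inner product below is
  treated in the same way.\<close>

lemma weighted_mask_norm:
  "(\<Sum>S\<in>UNIV. w S * (norm (mask S (x :: 'a::real_normed_vector^'n)))\<^sup>2) = q * (norm x)\<^sup>2"
proof -
  have "(\<Sum>S\<in>UNIV. w S * (norm (mask S x))\<^sup>2)
      = (\<Sum>S\<in>UNIV. \<Sum>n\<in>UNIV. w S * of_bool (n \<in> S) * (norm (x $ n))\<^sup>2)"
    by (simp only: norm_mask_squared sum_distrib_left mult.assoc)
  also have "\<dots> = (\<Sum>n\<in>UNIV. \<Sum>S\<in>UNIV. w S * of_bool (n \<in> S) * (norm (x $ n))\<^sup>2)"
    by (rule sum.swap)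
  also have "\<dots> = q * (norm x)\<^sup>2"
    by (simp add: sum_distrib_right[symmetric] w_incl norm_vec_squared sum_distrib_left)
  finally show ?thesis .
qed

lemma weighted_mask_compl_norm:
  assumes "(\<Sum>S\<in>UNIV. w S) = 1"
  shows "(\<Sum>S\<in>UNIV. w S * (norm (mask (- S) (x :: 'a::real_normed_vector^'n)))\<^sup>2) = (1 - q) * (norm x)\<^sup>2"
proof -
  have "(norm (mask (- S) x))\<^sup>2 = (norm x)\<^sup>2 - (norm (mask S x))\<^sup>2" for S
    unfolding norm_mask_squared norm_vec_squared[of x] sum_subtractf[symmetric]
    by (rule sum.cong) auto
  then have "(\<Sum>S\<in>UNIV. w S * (norm (mask (- S) x))\<^sup>2)
      = (\<Sum>S\<in>UNIV. w S) * (norm x)\<^sup>2 - (\<Sum>S\<in>UNIV. w S * (norm (mask S x))\<^sup>2)"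
    by (simp add: right_diff_distrib sum_subtractf sum_distrib_right)
  then show ?thesis using assms by (simp add: weighted_mask_norm algebra_simps)
qed

lemma weighted_mask_inner:
  "(\<Sum>S\<in>UNIV. w S * (y \<bullet> mask S (x :: 'a::real_inner^'n))) = q * (y \<bullet> x)"
proof -
  have "y \<bullet> mask S x = (\<Sum>n\<in>UNIV. of_bool (n \<in> S) * (y $ n \<bullet> x $ n))" for S
    unfolding inner_vec_def mask_def by (rule sum.cong) auto
  then have "(\<Sum>S\<in>UNIV. w S * (y \<bullet> mask S x))
      = (\<Sum>S\<in>UNIV. \<Sum>n\<in>UNIV. w S * of_bool (n \<in> S) * (y $ n \<bullet> x $ n))"
    by (simp only: sum_distrib_left mult.assoc)
  also have "\<dots> = (\<Sum>n\<in>UNIV. \<Sum>S\<in>UNIV. w S * of_bool (n \<in> S) * (y $ n \<bullet> x $ n))"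
    by (rule sum.swap)
  also have "\<dots> = q * (y \<bullet> x)"
    by (simp add: sum_distrib_right[symmetric] w_incl inner_vec_def sum_distrib_left)
  finally show ?thesis .
qed

end

text \<open>A refreshed row has error zero; in a stale row the new error is the old one minus the
  drift of the output. The mask on the old error is kept because it yields the contraction, while
  the one on the drift is estimated away.\<close>

lemma cache_error_update_le:
  fixes y y' c :: "real^'d^'n"
  assumes "0 < m" "m < 1"
  shows "(norm ((\<chi> n. if n \<in> S then y' $ n else c $ n) - y'))\<^sup>2
       \<le> (norm (mask (- S) (c - y)))\<^sup>2 / m + (norm (y' - y))\<^sup>2 / (1 - m)"
proof -
  have "(\<chi> n. if n \<in> S then y' $ n else c $ n) - y' = mask (- S) (c - y) - mask (- S) (y' - y)"
    by (simp add: mask_def vec_eq_iff)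
  then have "(norm ((\<chi> n. if n \<in> S then y' $ n else c $ n) - y'))\<^sup>2
      \<le> (norm (mask (- S) (c - y)))\<^sup>2 / m + (norm (mask (- S) (y' - y)))\<^sup>2 / (1 - m)"
    using norm_diff_squared_le[OF assms] by simp
  also have "\<dots> \<le> (norm (mask (- S) (c - y)))\<^sup>2 / m + (norm (y' - y))\<^sup>2 / (1 - m)"
    using assms by (intro add_left_mono divide_right_mono power_mono norm_mask_le) auto
  finally show ?thesis .
qed

text \<open>The Polyak-Lojasiewicz inequality, by completing the square in the quadratic lower
  bound.\<close>

lemma strongly_convex_on_gradient_bound:
  assumes "strongly_convex_on V F c" "c > 0" "y \<in> V" "y' \<in> V"
  shows "2 * c * (F y - F y') \<le> (norm (gradient F y))\<^sup>2"
proof -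
  let ?g = "gradient F y" and ?u = "y' - y"
  have "F y' \<ge> F y + ?g \<bullet> ?u + c / 2 * (norm ?u)\<^sup>2"
    using assms unfolding strongly_convex_on_def by blast
  then have "2 * c * (F y - F y') \<le> 2 * c * (- (?g \<bullet> ?u) - c / 2 * (norm ?u)\<^sup>2)"
    using assms(2) by (intro mult_left_mono) auto
  also have "\<dots> = (norm ?g)\<^sup>2 - (norm (?g + c *\<^sub>R ?u))\<^sup>2"
    unfolding power2_norm_eq_inner
    by (simp add: inner_add_left inner_add_right inner_commute[of "?u" "?g"]
        right_diff_distrib distrib_left mult.assoc)
  also have "\<dots> \<le> (norm ?g)\<^sup>2" by simp
  finally show ?thesis .
qed

text \<open>The mean value inequality with a bound on the segment alone, as (A6) supplies it. With
  \<open>G_diag\<close> it turns (A6) into a bound of the surrogate error by the cache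
  error.\<close>

lemma norm_diff_le_of_frechet_derivative_bound:
  fixes f :: "'a::euclidean_space \<Rightarrow> 'b::real_normed_vector"
  assumes "C1_map f"
    and "\<And>t h. t \<in> {0..1} \<Longrightarrow> norm (frechet_derivative f (at (x + t *\<^sub>R (x' - x))) h) \<le> K * norm h"
  shows "norm (f x' - f x) \<le> K * norm (x' - x)"
proof -
  obtain f' where f': "\<And>x. (f has_derivative blinfun_apply (f' x)) (at x)"
    using assms(1) unfolding C1_map_def by blast
  have "norm (f (x + (x' - x)) - f x) \<le> norm (x' - x) * K"
  proof (rule differentiable_bound_segment[of x "x' - x" UNIV f "\<lambda>x. frechet_derivative f (at x)"])
    show "(f has_derivative frechet_derivative f (at z)) (at z within UNIV)" for z
      using f' by (metis differentiableI frechet_derivative_works)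
    show "onorm (frechet_derivative f (at (x + t *\<^sub>R (x' - x)))) \<le> K" if "t \<in> {0..1}" for t
      using assms(2)[OF that] by (intro onorm_le)
  qed auto
  then show ?thesis by (simp add: mult.commute)
qed

text \<open>The deterministic smoothness bounds. (A5) and (A6) join later as inequalities at a
  single iterate, the form in which a positive-probability history delivers them.\<close>

locale surrogate_region =
  fixes Y :: "real^'s \<Rightarrow> real^'d^'n" and F :: "real^'d^'n \<Rightarrow> real"
    and \<Omega> :: "(real^'s) set" and V :: "(real^'d^'n) set" and B\<^sub>0 L B\<^sub>1 B\<^sub>2 :: real
  assumes Y_C2: "C2_map Y" and F_C1: "C1_map F"
    and convex_\<Omega>: "convex \<Omega>" and Y_maps: "Y ` \<Omega> \<subseteq> V"
    and nonneg: "0 \<le> B\<^sub>0" "0 \<le> L" "0 \<le> B\<^sub>1" "0 \<le> B\<^sub>2"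
    and gradient_bound: "\<And>y. y \<in> V \<Longrightarrow> norm (gradient F y) \<le> B\<^sub>0"
    and gradient_lipschitz: "\<And>y y'. y \<in> V \<Longrightarrow> y' \<in> V \<Longrightarrow>
          norm (gradient F y - gradient F y') \<le> L * norm (y - y')"
    and jacobian_bound: "\<And>\<theta>. \<theta> \<in> \<Omega> \<Longrightarrow> norm (full_jacobian Y \<theta>) \<le> B\<^sub>1"
    and hessian_bound: "\<And>\<theta>. \<theta> \<in> \<Omega> \<Longrightarrow> norm (second_derivative Y \<theta>) \<le> B\<^sub>2"
begin

lemma norm_output_adjoint_region:
  "\<theta> \<in> \<Omega> \<Longrightarrow> norm (output_adjoint Y \<theta> p) \<le> B\<^sub>1 * norm p"
  by (meson jacobian_bound mult_right_mono norm_ge_zero norm_output_adjoint_le order_trans)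

lemma norm_output_derivative_region:
  "\<theta> \<in> \<Omega> \<Longrightarrow> norm (output_derivative Y \<theta> h) \<le> B\<^sub>1 * norm h"
  by (meson jacobian_bound mult_right_mono norm_ge_zero norm_output_derivative_le order_trans)

lemma has_derivative_loss:
  "((\<lambda>x. F (Y x)) has_derivative (\<lambda>h. gradient F (Y \<theta>) \<bullet> output_derivative Y \<theta> h)) (at \<theta>)"
proof -
  obtain F' where "\<And>x. (F has_derivative blinfun_apply (F' x)) (at x)"
    using F_C1 unfolding C1_map_def by blast
  then have "(F has_derivative (\<lambda>h. gradient F (Y \<theta>) \<bullet> h)) (at (Y \<theta>))"
    by (rule has_derivative_gradient)
  from has_derivative_compose[OF C2_map_has_derivative_output[OF Y_C2] this] show ?thesis .
qed

text \<open>Product rule: changing the gradient costs \<open>L * B\<^sub>1 * B\<^sub>1\<close>,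
  changing the Jacobian costs \<open>B\<^sub>0 * B\<^sub>2\<close>. This is the bracket in
  \<open>c\<^sub>2\<close>.\<close>

lemma loss_derivative_lipschitz:
  assumes "\<theta> \<in> \<Omega>" "\<theta>' \<in> \<Omega>"
  shows "\<bar>gradient F (Y \<theta>) \<bullet> output_derivative Y \<theta> h - gradient F (Y \<theta>') \<bullet> output_derivative Y \<theta>' h\<bar>
       \<le> (L * B\<^sub>1\<^sup>2 + B\<^sub>0 * B\<^sub>2) * norm (\<theta> - \<theta>') * norm h"
proof -
  let ?g = "gradient F (Y \<theta>)" and ?g' = "gradient F (Y \<theta>')"
  let ?D = "output_derivative Y \<theta> h" and ?D' = "output_derivative Y \<theta>' h"
  have V: "Y \<theta> \<in> V" "Y \<theta>' \<in> V" using assms Y_maps by auto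
  have "norm (Y \<theta> - Y \<theta>') \<le> B\<^sub>1 * norm (\<theta> - \<theta>')"
    by (rule output_Lipschitz[OF Y_C2 convex_\<Omega> jacobian_bound assms])
  then have "norm (?g - ?g') \<le> L * (B\<^sub>1 * norm (\<theta> - \<theta>'))"
    using gradient_lipschitz[OF V] nonneg(2) by (meson mult_left_mono order_trans)
  then have "norm (?g - ?g') * norm ?D \<le> L * (B\<^sub>1 * norm (\<theta> - \<theta>')) * (B\<^sub>1 * norm h)"
    using norm_output_derivative_region[OF assms(1)] nonneg by (intro mult_mono) auto
  moreover have "norm (full_jacobian Y \<theta> - full_jacobian Y \<theta>') * norm h \<le> B\<^sub>2 * norm (\<theta> - \<theta>') * norm h"
    by (intro mult_right_mono full_jacobian_Lipschitz[OF Y_C2 convex_\<Omega> hessian_bound assms]) auto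
  then have "norm (?D - ?D') \<le> B\<^sub>2 * norm (\<theta> - \<theta>') * norm h"
    using norm_output_derivative_diff_le order_trans by blast
  then have "norm ?g' * norm (?D - ?D') \<le> B\<^sub>0 * (B\<^sub>2 * norm (\<theta> - \<theta>') * norm h)"
    using gradient_bound[OF V(2)] nonneg by (intro mult_mono) auto
  moreover have "\<bar>?g \<bullet> ?D - ?g' \<bullet> ?D'\<bar> \<le> \<bar>(?g - ?g') \<bullet> ?D\<bar> + \<bar>?g' \<bullet> (?D - ?D')\<bar>"
    by (simp add: inner_diff_left inner_diff_right)
  moreover have "\<bar>(?g - ?g') \<bullet> ?D\<bar> \<le> norm (?g - ?g') * norm ?D"
    "\<bar>?g' \<bullet> (?D - ?D')\<bar> \<le> norm ?g' * norm (?D - ?D')"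
    by (rule Cauchy_Schwarz_ineq2)+
  ultimately show ?thesis by (simp add: algebra_simps power2_eq_square)
qed

lemma loss_descent:
  assumes "\<theta> \<in> \<Omega>" and "\<theta> - \<eta> *\<^sub>R output_adjoint Y \<theta> p \<in> \<Omega>"
  shows "F (Y (\<theta> - \<eta> *\<^sub>R output_adjoint Y \<theta> p))
       \<le> F (Y \<theta>) - \<eta> * (output_adjoint Y \<theta> (gradient F (Y \<theta>)) \<bullet> output_adjoint Y \<theta> p)
          + 1/2 * (L * B\<^sub>1\<^sup>2 + B\<^sub>0 * B\<^sub>2) * B\<^sub>1\<^sup>2 * \<eta>\<^sup>2 * (norm p)\<^sup>2"
proof -
  let ?H = "output_adjoint Y \<theta> p" and ?K = "L * B\<^sub>1\<^sup>2 + B\<^sub>0 * B\<^sub>2"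
  have "F (Y (\<theta> - \<eta> *\<^sub>R ?H)) \<le> F (Y \<theta>)
      + gradient F (Y \<theta>) \<bullet> output_derivative Y \<theta> (\<theta> - \<eta> *\<^sub>R ?H - \<theta>)
      + ?K / 2 * (norm (\<theta> - \<eta> *\<^sub>R ?H - \<theta>))\<^sup>2"
    by (rule descent_inequality[OF convex_\<Omega> has_derivative_loss loss_derivative_lipschitz assms])
  also have "gradient F (Y \<theta>) \<bullet> output_derivative Y \<theta> (\<theta> - \<eta> *\<^sub>R ?H - \<theta>)
      = - \<eta> * (output_adjoint Y \<theta> (gradient F (Y \<theta>)) \<bullet> ?H)"
    unfolding output_adjoint_inner[symmetric] by simp
  also have "(norm (\<theta> - \<eta> *\<^sub>R ?H - \<theta>))\<^sup>2 = \<eta>\<^sup>2 * (norm ?H)\<^sup>2"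
    by (simp add: power_mult_distrib)
  finally have *: "F (Y (\<theta> - \<eta> *\<^sub>R ?H)) \<le> F (Y \<theta>)
      + - \<eta> * (output_adjoint Y \<theta> (gradient F (Y \<theta>)) \<bullet> ?H) + ?K / 2 * (\<eta>\<^sup>2 * (norm ?H)\<^sup>2)" .
  have "(norm ?H)\<^sup>2 \<le> (B\<^sub>1 * norm p)\<^sup>2"
    by (intro power_mono norm_output_adjoint_region assms) simp
  then have "?K / 2 * (\<eta>\<^sup>2 * (norm ?H)\<^sup>2) \<le> ?K / 2 * (\<eta>\<^sup>2 * (B\<^sub>1 * norm p)\<^sup>2)"
    using nonneg by (intro mult_left_mono) auto
  then show ?thesis using * by (simp add: power_mult_distrib mult_ac)
qed

text \<open>The fourth power of \<open>B\<^sub>1\<close> arises because the step passes through the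
  Jacobian twice, as adjoint from outputs to parameters and then back to outputs; the drift is
  squared.\<close>

lemma cache_error_descent:
  assumes "\<theta> \<in> \<Omega>" and "\<theta> - \<eta> *\<^sub>R output_adjoint Y \<theta> p \<in> \<Omega>" and m: "0 < m" "m < 1"
  defines "\<theta>' \<equiv> \<theta> - \<eta> *\<^sub>R output_adjoint Y \<theta> p"
  shows "(norm ((\<chi> n. if n \<in> S then Y \<theta>' $ n else c $ n) - Y \<theta>'))\<^sup>2
       \<le> (norm (mask (- S) (c - Y \<theta>)))\<^sup>2 / m + \<eta>\<^sup>2 * B\<^sub>1 ^ 4 * (norm p)\<^sup>2 / (1 - m)"
proof -
  have "norm (Y \<theta>' - Y \<theta>) \<le> B\<^sub>1 * norm (\<theta>' - \<theta>)"
    unfolding \<theta>'_def by (rule output_Lipschitz[OF Y_C2 convex_\<Omega> jacobian_bound assms(2,1)])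
  also have "norm (\<theta>' - \<theta>) = \<bar>\<eta>\<bar> * norm (output_adjoint Y \<theta> p)"
    by (simp add: \<theta>'_def)
  also have "B\<^sub>1 * \<dots> \<le> B\<^sub>1 * (\<bar>\<eta>\<bar> * (B\<^sub>1 * norm p))"
    by (intro mult_left_mono norm_output_adjoint_region assms(1)) (use nonneg in auto)
  finally have "(norm (Y \<theta>' - Y \<theta>))\<^sup>2 \<le> (B\<^sub>1 * (\<bar>\<eta>\<bar> * (B\<^sub>1 * norm p)))\<^sup>2"
    by (rule power_mono) simp
  also have "\<dots> = \<eta>\<^sup>2 * B\<^sub>1 ^ 4 * (norm p)\<^sup>2"
    by (simp add: power2_eq_square power4_eq_xxxx mult_ac)
  finally have "(norm (Y \<theta>' - Y \<theta>))\<^sup>2 / (1 - m) \<le> \<eta>\<^sup>2 * B\<^sub>1 ^ 4 * (norm p)\<^sup>2 / (1 - m)"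
    using m by (intro divide_right_mono) auto
  then show ?thesis using cache_error_update_le[OF m, where y = "Y \<theta>" and y' = "Y \<theta>'" and S = S and c = c]
    by linarith
qed

end

context surrogate_region
begin

lemma expected_one_step:
  fixes w :: "'n set \<Rightarrow> real"
  assumes \<theta>: "\<theta> \<in> \<Omega>" and m: "0 < m" "m < 1" and q: "q = 1 - m\<^sup>2" and \<kappa>: "0 \<le> \<kappa>"
    and w: "\<And>S. 0 \<le> w S" "(\<Sum>S\<in>UNIV. w S) = 1" "\<And>n. (\<Sum>S\<in>UNIV. w S * of_bool (n \<in> S)) = q"
    and next_in: "\<And>S. w S \<noteq> 0 \<Longrightarrow> \<theta> - \<eta> *\<^sub>R output_adjoint Y \<theta> (mask S p) \<in> \<Omega>"
  defines "\<theta>' \<equiv> \<lambda>S. \<theta> - \<eta> *\<^sub>R output_adjoint Y \<theta> (mask S p)"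
  shows "(\<Sum>S\<in>UNIV. w S * (F (Y (\<theta>' S))
           + \<kappa> * (norm ((\<chi> n. if n \<in> S then Y (\<theta>' S) $ n else c $ n) - Y (\<theta>' S)))\<^sup>2))
       \<le> F (Y \<theta>) - \<eta> * q * (output_adjoint Y \<theta> (gradient F (Y \<theta>)) \<bullet> output_adjoint Y \<theta> p)
          + 1/2 * (L * B\<^sub>1\<^sup>2 + B\<^sub>0 * B\<^sub>2) * B\<^sub>1\<^sup>2 * \<eta>\<^sup>2 * q * (norm p)\<^sup>2
          + \<kappa> * (m * (norm (c - Y \<theta>))\<^sup>2 + \<eta>\<^sup>2 * B\<^sub>1 ^ 4 * q / (1 - m) * (norm p)\<^sup>2)"
proof -
  let ?K = "1/2 * (L * B\<^sub>1\<^sup>2 + B\<^sub>0 * B\<^sub>2) * B\<^sub>1\<^sup>2 * \<eta>\<^sup>2"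
  let ?R = "\<eta>\<^sup>2 * B\<^sub>1 ^ 4 / (1 - m)"
  \<comment> \<open>This is J J^T g. Moving the adjoint across the inner product makes the cross
    term linear in the masked vector, as \<open>weighted_mask_inner\<close> requires.\<close>
  let ?v = "output_derivative Y \<theta> (output_adjoint Y \<theta> (gradient F (Y \<theta>)))"
  have v: "output_adjoint Y \<theta> (gradient F (Y \<theta>)) \<bullet> output_adjoint Y \<theta> p' = ?v \<bullet> p'" for p'
    using output_adjoint_inner[of Y \<theta> p' "output_adjoint Y \<theta> (gradient F (Y \<theta>))"]
    by (simp add: inner_commute)
  have "(\<Sum>S\<in>UNIV. w S * (F (Y (\<theta>' S))
           + \<kappa> * (norm ((\<chi> n. if n \<in> S then Y (\<theta>' S) $ n else c $ n) - Y (\<theta>' S)))\<^sup>2))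
     \<le> (\<Sum>S\<in>UNIV. w S * F (Y \<theta>) - \<eta> * (w S * (?v \<bullet> mask S p)) + ?K * (w S * (norm (mask S p))\<^sup>2)
         + \<kappa> / m * (w S * (norm (mask (- S) (c - Y \<theta>)))\<^sup>2) + \<kappa> * ?R * (w S * (norm (mask S p))\<^sup>2))"
  proof (rule sum_mono)
    fix S
    show "w S * (F (Y (\<theta>' S))
           + \<kappa> * (norm ((\<chi> n. if n \<in> S then Y (\<theta>' S) $ n else c $ n) - Y (\<theta>' S)))\<^sup>2)
     \<le> w S * F (Y \<theta>) - \<eta> * (w S * (?v \<bullet> mask S p)) + ?K * (w S * (norm (mask S p))\<^sup>2)
         + \<kappa> / m * (w S * (norm (mask (- S) (c - Y \<theta>)))\<^sup>2) + \<kappa> * ?R * (w S * (norm (mask S p))\<^sup>2)"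
    \<comment> \<open>A batch of weight zero may lead out of \<open>\<Omega>\<close>, where no
      estimate is available, but its term vanishes.\<close>
    proof (cases "w S = 0")
      case False
      have "F (Y (\<theta>' S)) \<le> F (Y \<theta>) - \<eta> * (?v \<bullet> mask S p) + ?K * (norm (mask S p))\<^sup>2"
        using loss_descent[OF \<theta> next_in[OF False]] unfolding v \<theta>'_def .
      moreover have "\<kappa> * (norm ((\<chi> n. if n \<in> S then Y (\<theta>' S) $ n else c $ n) - Y (\<theta>' S)))\<^sup>2
          \<le> \<kappa> * ((norm (mask (- S) (c - Y \<theta>)))\<^sup>2 / m + \<eta>\<^sup>2 * B\<^sub>1 ^ 4 * (norm (mask S p))\<^sup>2 / (1 - m))"
        unfolding \<theta>'_def by (intro mult_left_mono cache_error_descent \<theta> next_in False m \<kappa>)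
      ultimately have "w S * (F (Y (\<theta>' S))
           + \<kappa> * (norm ((\<chi> n. if n \<in> S then Y (\<theta>' S) $ n else c $ n) - Y (\<theta>' S)))\<^sup>2)
        \<le> w S * (F (Y \<theta>) - \<eta> * (?v \<bullet> mask S p) + ?K * (norm (mask S p))\<^sup>2
          + \<kappa> * ((norm (mask (- S) (c - Y \<theta>)))\<^sup>2 / m + \<eta>\<^sup>2 * B\<^sub>1 ^ 4 * (norm (mask S p))\<^sup>2 / (1 - m)))"
        by (intro mult_left_mono w(1)) linarith
      then show ?thesis by (simp add: distrib_left right_diff_distrib mult_ac)
    qed simp
  qed
  also have "\<dots> = F (Y \<theta>) - \<eta> * (q * (?v \<bullet> p)) + ?K * (q * (norm p)\<^sup>2)
      + \<kappa> / m * ((1 - q) * (norm (c - Y \<theta>))\<^sup>2) + \<kappa> * ?R * (q * (norm p)\<^sup>2)"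
    unfolding sum.distrib sum_subtractf sum_distrib_left[symmetric] sum_distrib_right[symmetric]
      weighted_mask_norm[OF w(3)] weighted_mask_inner[OF w(3)] weighted_mask_compl_norm[OF w(3,2)]
    by (simp add: w(2))
  \<comment> \<open>Here \<open>(1 - q) / m = m\<close>: the Young weight is the square root of the
    survival probability of a row.\<close>
  also have "\<dots> = F (Y \<theta>) - \<eta> * q * (?v \<bullet> p) + ?K * q * (norm p)\<^sup>2
      + \<kappa> * (m * (norm (c - Y \<theta>))\<^sup>2 + \<eta>\<^sup>2 * B\<^sub>1 ^ 4 * q / (1 - m) * (norm p)\<^sup>2)"
    using m by (simp add: q power2_eq_square distrib_left mult_ac)
  finally show ?thesis unfolding v .
qed

end

section \<open>Balancing the constants and the step size\<close>

text \<open>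
  Half of the contraction \<open>\<kappa> (1 - m)\<close> of the cache error pays for the surrogate error in the loss
  descent, and the step size bound \<open>step\<close> makes another eighth pay for the drift of the outputs.
\<close>

lemma lyapunov_coefficients:
  fixes q m \<eta> B\<^sub>1 B\<^sub>3 c\<^sub>2 c\<^sub>5 \<nu> lam g d z x p \<kappa> :: real
  assumes m: "0 < m" "m < 1" and q: "q = 1 - m\<^sup>2" and \<nu>: "m \<le> \<nu>" "\<nu> < 1"
    and step: "16 * q * (\<eta>\<^sup>2 * B\<^sub>1 ^ 4 * B\<^sub>3\<^sup>2) \<le> (1 - m)\<^sup>2"
    and c\<^sub>2: "0 \<le> c\<^sub>2" and \<eta>: "0 < \<eta>"
    and c\<^sub>5: "c\<^sub>5 = 4 * c\<^sub>2 + q / 2 * B\<^sub>1 ^ 4 + 2 * q * B\<^sub>1 ^ 4 * B\<^sub>3\<^sup>2 / (m * (1 - m) * (1 - \<nu>))"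
    and z: "lam * g\<^sup>2 \<le> z\<^sup>2" and x: "z\<^sup>2 - B\<^sub>1\<^sup>2 * B\<^sub>3 * g * d \<le> x"
    and p: "p\<^sup>2 \<le> 2 * g\<^sup>2 + 2 * B\<^sub>3\<^sup>2 * d\<^sup>2"
    and \<kappa>: "\<kappa> = q * B\<^sub>3\<^sup>2 * (1 + 4 * c\<^sub>2 * \<eta>\<^sup>2) / (1 - m)"
  shows "- \<eta> * q * x + c\<^sub>2 * \<eta>\<^sup>2 * q * p\<^sup>2 + \<kappa> * (m * d\<^sup>2 + \<eta>\<^sup>2 * B\<^sub>1 ^ 4 * q / (1 - m) * p\<^sup>2)
       \<le> - \<eta> * (q * lam - \<eta> * c\<^sub>5) * g\<^sup>2 + (1 - 3/8 * (1 - m)) * (\<kappa> * d\<^sup>2)"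
proof -
  have q01: "0 < q" "q < 1" using m by (auto simp: q power_less_one_iff)
  have q': "q = (1 - m) * (1 + m)" by (simp add: q power2_eq_square algebra_simps)
  have \<kappa>0: "0 \<le> \<kappa>" using q01 c\<^sub>2 m by (simp add: \<kappa>)
  \<comment> \<open>The right side is twice the \<open>d\<^sup>2\<close> coefficient of the loss
    descent: \<open>q / 2 * B\<^sub>3\<^sup>2\<close> from the cross term and
    \<open>2 * c\<^sub>2 * \<eta>\<^sup>2 * q * B\<^sub>3\<^sup>2\<close> from
    \<open>p\<^sup>2\<close>.\<close>
  have \<kappa>m: "\<kappa> * (1 - m) = q * B\<^sub>3\<^sup>2 * (1 + 4 * c\<^sub>2 * \<eta>\<^sup>2)" using m by (simp add: \<kappa>)
  define a where "a = c\<^sub>2 * \<eta>\<^sup>2 * q + \<kappa> * (\<eta>\<^sup>2 * B\<^sub>1 ^ 4 * q / (1 - m))"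
  have a0: "0 \<le> a" using c\<^sub>2 q01 \<kappa>0 m by (simp add: a_def)
  have ap: "a * p\<^sup>2 \<le> a * (2 * g\<^sup>2 + 2 * B\<^sub>3\<^sup>2 * d\<^sup>2)" by (rule mult_left_mono[OF p a0])
  have "\<eta> * q * (lam * g\<^sup>2 - B\<^sub>1\<^sup>2 * B\<^sub>3 * g * d) \<le> \<eta> * q * x"
    using z x \<eta> q01 by (intro mult_left_mono) auto
  \<comment> \<open>All of \<open>\<eta>\<close> goes to the \<open>g\<close> factor: its square has
    second order in \<open>\<eta>\<close> and fits into \<open>c\<^sub>5\<close>, while the
    \<open>d\<^sup>2\<close> term without \<open>\<eta>\<close> is left to
    \<open>\<kappa>\<close>.\<close>
  moreover have "\<eta> * q * (B\<^sub>1\<^sup>2 * B\<^sub>3 * g * d) \<le> q / 2 * (\<eta>\<^sup>2 * B\<^sub>1 ^ 4 * g\<^sup>2) + q / 2 * (B\<^sub>3\<^sup>2 * d\<^sup>2)"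
  proof -
    have "0 \<le> q / 2 * (\<eta> * B\<^sub>1\<^sup>2 * g - B\<^sub>3 * d)\<^sup>2" using q01 by simp
    then show ?thesis by (simp add: power2_eq_square power4_eq_xxxx algebra_simps)
  qed
  ultimately have main: "- \<eta> * q * x \<le> - \<eta> * q * lam * g\<^sup>2 + q / 2 * \<eta>\<^sup>2 * B\<^sub>1 ^ 4 * g\<^sup>2 + q / 2 * B\<^sub>3\<^sup>2 * d\<^sup>2"
    by (simp add: algebra_simps)
  have drift: "q * (\<eta>\<^sup>2 * B\<^sub>1 ^ 4 * B\<^sub>3\<^sup>2) / (1 - m) \<le> (1 - m) / 16"
    using step m by (simp add: field_simps power2_eq_square)
  have d_coeff: "q / 2 * B\<^sub>3\<^sup>2 + 2 * a * B\<^sub>3\<^sup>2 + \<kappa> * m \<le> \<kappa> * (1 - 3/8 * (1 - m))"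
  proof -
    have "2 * a * B\<^sub>3\<^sup>2 = 2 * c\<^sub>2 * \<eta>\<^sup>2 * q * B\<^sub>3\<^sup>2 + 2 * \<kappa> * (q * (\<eta>\<^sup>2 * B\<^sub>1 ^ 4 * B\<^sub>3\<^sup>2) / (1 - m))"
      by (simp add: a_def algebra_simps)
    also have "\<dots> \<le> 2 * c\<^sub>2 * \<eta>\<^sup>2 * q * B\<^sub>3\<^sup>2 + 2 * \<kappa> * ((1 - m) / 16)"
      using drift \<kappa>0 by (intro add_left_mono mult_left_mono) auto
    finally have "2 * a * B\<^sub>3\<^sup>2 \<le> 2 * c\<^sub>2 * \<eta>\<^sup>2 * q * B\<^sub>3\<^sup>2 + \<kappa> * (1 - m) / 8" by simp
    moreover have "q / 2 * B\<^sub>3\<^sup>2 + 2 * c\<^sub>2 * \<eta>\<^sup>2 * q * B\<^sub>3\<^sup>2 = \<kappa> * (1 - m) / 2"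
      unfolding \<kappa>m by (simp add: algebra_simps)
    ultimately have "q / 2 * B\<^sub>3\<^sup>2 + 2 * a * B\<^sub>3\<^sup>2 \<le> \<kappa> * (1 - m) * 5 / 8"
      by linarith
    moreover have "\<kappa> * (1 - 3/8 * (1 - m)) = \<kappa> * m + \<kappa> * (1 - m) * 5 / 8" by (simp add: field_simps)
    ultimately show ?thesis by linarith
  qed
  have g_coeff: "q / 2 * \<eta>\<^sup>2 * B\<^sub>1 ^ 4 + 2 * a \<le> \<eta>\<^sup>2 * c\<^sub>5"
  proof -
    \<comment> \<open>The main part of \<open>\<kappa>\<close> in the drift. One factor
      \<open>q / (1 - m)\<close> is \<open>1 + m\<close>, and \<open>1 - \<nu> \<le> 1 - m\<close>
      leads to the denominator in \<open>c\<^sub>5\<close>.\<close>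
    have one: "2 * q\<^sup>2 * B\<^sub>1 ^ 4 * B\<^sub>3\<^sup>2 / (1 - m)\<^sup>2 \<le> 2 * q * B\<^sub>1 ^ 4 * B\<^sub>3\<^sup>2 / (m * (1 - m) * (1 - \<nu>))"
    proof -
      have "m * (1 - \<nu>) * (1 + m) \<le> m * (1 - m) * (1 + m)"
        using m \<nu> by (intro mult_right_mono mult_left_mono) auto
      also have "\<dots> = m * q" by (simp add: q')
      also have "\<dots> \<le> 1" using m q01 by (intro mult_le_one) auto
      finally have "1 + m \<le> 1 / (m * (1 - \<nu>))"
        using m \<nu> by (simp add: pos_le_divide_eq mult_ac)
      then have "2 * q * B\<^sub>1 ^ 4 * B\<^sub>3\<^sup>2 / (1 - m) * (1 + m) \<le> 2 * q * B\<^sub>1 ^ 4 * B\<^sub>3\<^sup>2 / (1 - m) * (1 / (m * (1 - \<nu>)))"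
        using m q01 by (intro mult_left_mono) auto
      moreover have "2 * q\<^sup>2 * B\<^sub>1 ^ 4 * B\<^sub>3\<^sup>2 / (1 - m)\<^sup>2 = 2 * q * B\<^sub>1 ^ 4 * B\<^sub>3\<^sup>2 / (1 - m) * (q / (1 - m))"
        by (simp add: power2_eq_square)
      moreover have "q / (1 - m) = 1 + m" using m by (simp add: q')
      ultimately show ?thesis by (simp add: mult_ac)
    qed
    \<comment> \<open>The contribution of the correction
      \<open>4 * c\<^sub>2 * \<eta>\<^sup>2\<close> in \<open>\<kappa>\<close>; together with
      \<open>2 * c\<^sub>2 * q\<close> it stays below the \<open>4 * c\<^sub>2\<close> in
      \<open>c\<^sub>5\<close>.\<close>
    have two: "8 * q\<^sup>2 * c\<^sub>2 * (\<eta>\<^sup>2 * B\<^sub>1 ^ 4 * B\<^sub>3\<^sup>2) / (1 - m)\<^sup>2 \<le> c\<^sub>2 / 2"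
    proof -
      have "q * c\<^sub>2 / 2 * (16 * q * (\<eta>\<^sup>2 * B\<^sub>1 ^ 4 * B\<^sub>3\<^sup>2)) \<le> q * c\<^sub>2 / 2 * (1 - m)\<^sup>2"
        using q01 c\<^sub>2 by (intro mult_left_mono step) auto
      also have "\<dots> \<le> c\<^sub>2 / 2 * (1 - m)\<^sup>2"
        using q01 c\<^sub>2 by (intro mult_right_mono) (auto simp: mult_left_le_one_le)
      finally show ?thesis using m by (simp add: pos_divide_le_eq power2_eq_square mult_ac)
    qed
    have "q / 2 * \<eta>\<^sup>2 * B\<^sub>1 ^ 4 + 2 * a
        = \<eta>\<^sup>2 * (q / 2 * B\<^sub>1 ^ 4 + 2 * c\<^sub>2 * q + 2 * q\<^sup>2 * B\<^sub>1 ^ 4 * B\<^sub>3\<^sup>2 / (1 - m)\<^sup>2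
            + 8 * q\<^sup>2 * c\<^sub>2 * (\<eta>\<^sup>2 * B\<^sub>1 ^ 4 * B\<^sub>3\<^sup>2) / (1 - m)\<^sup>2)"
      using m by (simp add: a_def \<kappa> power2_eq_square add_divide_distrib algebra_simps)
    also have "\<dots> \<le> \<eta>\<^sup>2 * c\<^sub>5"
    proof (rule mult_left_mono)
      have "2 * c\<^sub>2 * q \<le> 2 * c\<^sub>2 * 1" using q01 c\<^sub>2 by (intro mult_left_mono) auto
      then show "q / 2 * B\<^sub>1 ^ 4 + 2 * c\<^sub>2 * q + 2 * q\<^sup>2 * B\<^sub>1 ^ 4 * B\<^sub>3\<^sup>2 / (1 - m)\<^sup>2
            + 8 * q\<^sup>2 * c\<^sub>2 * (\<eta>\<^sup>2 * B\<^sub>1 ^ 4 * B\<^sub>3\<^sup>2) / (1 - m)\<^sup>2 \<le> c\<^sub>5"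
        unfolding c\<^sub>5 using one two c\<^sub>2 by linarith
    qed simp
    finally show ?thesis .
  qed
  have "- \<eta> * q * x + c\<^sub>2 * \<eta>\<^sup>2 * q * p\<^sup>2 + \<kappa> * (m * d\<^sup>2 + \<eta>\<^sup>2 * B\<^sub>1 ^ 4 * q / (1 - m) * p\<^sup>2)
      = - \<eta> * q * x + a * p\<^sup>2 + \<kappa> * m * d\<^sup>2"
    by (simp add: a_def algebra_simps)
  also have "\<dots> \<le> - \<eta> * q * lam * g\<^sup>2 + q / 2 * \<eta>\<^sup>2 * B\<^sub>1 ^ 4 * g\<^sup>2 + q / 2 * B\<^sub>3\<^sup>2 * d\<^sup>2
      + a * (2 * g\<^sup>2 + 2 * B\<^sub>3\<^sup>2 * d\<^sup>2) + \<kappa> * m * d\<^sup>2"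
    using main ap by linarith
  also have "\<dots> = - \<eta> * q * lam * g\<^sup>2 + (q / 2 * \<eta>\<^sup>2 * B\<^sub>1 ^ 4 + 2 * a) * g\<^sup>2
      + (q / 2 * B\<^sub>3\<^sup>2 + 2 * a * B\<^sub>3\<^sup>2 + \<kappa> * m) * d\<^sup>2"
    by (simp add: algebra_simps)
  also have "\<dots> \<le> - \<eta> * q * lam * g\<^sup>2 + (\<eta>\<^sup>2 * c\<^sub>5) * g\<^sup>2 + (\<kappa> * (1 - 3/8 * (1 - m))) * d\<^sup>2"
    by (intro add_mono[OF add_left_mono] mult_right_mono g_coeff d_coeff) auto
  also have "\<dots> = - \<eta> * (q * lam - \<eta> * c\<^sub>5) * g\<^sup>2 + (1 - 3/8 * (1 - m)) * (\<kappa> * d\<^sup>2)"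
    by (simp add: algebra_simps power2_eq_square)
  finally show ?thesis .
qed

lemma (in surrogate_region) lyapunov_contraction:
  fixes w :: "'n set \<Rightarrow> real" and p c :: "real^'d^'n"
    and m q \<eta> B\<^sub>3 c\<^sub>2 c\<^sub>5 c\<^sub>Y \<nu> lam \<kappa> Fmin :: real
  assumes \<theta>: "\<theta> \<in> \<Omega>" and m: "0 < m" "m < 1" and q: "q = 1 - m\<^sup>2" and \<nu>: "m \<le> \<nu>" "\<nu> < 1"
    and step: "16 * q * (\<eta>\<^sup>2 * B\<^sub>1 ^ 4 * B\<^sub>3\<^sup>2) \<le> (1 - m)\<^sup>2" and \<eta>: "0 < \<eta>"
    and c\<^sub>2: "c\<^sub>2 = 1/2 * (L * B\<^sub>1\<^sup>2 + B\<^sub>0 * B\<^sub>2) * B\<^sub>1\<^sup>2"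
    and c\<^sub>5: "c\<^sub>5 = 4 * c\<^sub>2 + q / 2 * B\<^sub>1 ^ 4 + 2 * q * B\<^sub>1 ^ 4 * B\<^sub>3\<^sup>2 / (m * (1 - m) * (1 - \<nu>))"
    and rate: "\<eta> * c\<^sub>5 \<le> q * lam"
    and \<kappa>: "\<kappa> = q * B\<^sub>3\<^sup>2 * (1 + 4 * c\<^sub>2 * \<eta>\<^sup>2) / (1 - m)" and B\<^sub>3: "0 \<le> B\<^sub>3"
    and w: "\<And>S. 0 \<le> w S" "(\<Sum>S\<in>UNIV. w S) = 1" "\<And>n. (\<Sum>S\<in>UNIV. w S * of_bool (n \<in> S)) = q"
    and next_in: "\<And>S. w S \<noteq> 0 \<Longrightarrow> \<theta> - \<eta> *\<^sub>R output_adjoint Y \<theta> (mask S p) \<in> \<Omega>"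
    and coercive: "\<And>v. lam * (norm v)\<^sup>2 \<le> (norm (output_adjoint Y \<theta> v))\<^sup>2"
    and surrogate: "norm (p - gradient F (Y \<theta>)) \<le> B\<^sub>3 * norm (c - Y \<theta>)"
    and convex: "2 * c\<^sub>Y * (F (Y \<theta>) - Fmin) \<le> (norm (gradient F (Y \<theta>)))\<^sup>2"
    and Fmin: "\<And>y. Fmin \<le> F y"
  defines "\<theta>' \<equiv> \<lambda>S. \<theta> - \<eta> *\<^sub>R output_adjoint Y \<theta> (mask S p)"
  shows "(\<Sum>S\<in>UNIV. w S * (F (Y (\<theta>' S)) - Fmin
           + \<kappa> * (norm ((\<chi> n. if n \<in> S then Y (\<theta>' S) $ n else c $ n) - Y (\<theta>' S)))\<^sup>2))
       \<le> max (1 - 2 * c\<^sub>Y * (\<eta> * (q * lam - \<eta> * c\<^sub>5))) (1 - 3/8 * (1 - m))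
          * (F (Y \<theta>) - Fmin + \<kappa> * (norm (c - Y \<theta>))\<^sup>2)"
proof -
  let ?g = "gradient F (Y \<theta>)" and ?d = "norm (c - Y \<theta>)" and ?J = "output_adjoint Y \<theta>"
  let ?D = "\<lambda>S. (norm ((\<chi> n. if n \<in> S then Y (\<theta>' S) $ n else c $ n) - Y (\<theta>' S)))\<^sup>2"
  let ?\<delta> = "\<eta> * (q * lam - \<eta> * c\<^sub>5)"
  have c\<^sub>20: "0 \<le> c\<^sub>2" using nonneg by (simp add: c\<^sub>2)
  have q0: "0 \<le> q" using m by (simp add: q power_le_one)
  have \<kappa>0: "0 \<le> \<kappa>" using q0 c\<^sub>20 m by (simp add: \<kappa>)
  have \<delta>0: "0 \<le> ?\<delta>" using rate \<eta> by simp
  \<comment> \<open>Replacing p by g in the cross term costs \<open>B\<^sub>1\<close> for each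
    adjoint and \<open>B\<^sub>3\<close> for the surrogate.\<close>
  have x: "(norm (?J ?g))\<^sup>2 - B\<^sub>1\<^sup>2 * B\<^sub>3 * norm ?g * ?d \<le> ?J ?g \<bullet> ?J p"
  proof -
    have "?J p = ?J ?g + ?J (p - ?g)"
      by (simp add: linear_add[OF linear_output_adjoint, symmetric])
    then have "?J ?g \<bullet> ?J p = (norm (?J ?g))\<^sup>2 + ?J ?g \<bullet> ?J (p - ?g)"
      by (simp add: inner_add_right power2_norm_eq_inner)
    moreover have "\<bar>?J ?g \<bullet> ?J (p - ?g)\<bar> \<le> norm (?J ?g) * norm (?J (p - ?g))"
      by (rule Cauchy_Schwarz_ineq2)
    moreover have "norm (?J ?g) * norm (?J (p - ?g)) \<le> (B\<^sub>1 * norm ?g) * (B\<^sub>1 * (B\<^sub>3 * ?d))"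
      using nonneg surrogate order_trans[OF norm_output_adjoint_region[OF \<theta>] mult_left_mono]
      by (intro mult_mono norm_output_adjoint_region \<theta>) auto
    ultimately show ?thesis by (simp add: power2_eq_square mult_ac)
  qed
  have p: "(norm p)\<^sup>2 \<le> 2 * (norm ?g)\<^sup>2 + 2 * B\<^sub>3\<^sup>2 * ?d\<^sup>2"
  proof -
    have "norm p \<le> norm ?g + B\<^sub>3 * ?d"
      using norm_triangle_ineq[of ?g "p - ?g"] surrogate by simp
    then have "(norm p)\<^sup>2 \<le> (norm ?g + B\<^sub>3 * ?d)\<^sup>2" by (rule power_mono) simp
    also have "\<dots> \<le> 2 * (norm ?g)\<^sup>2 + 2 * (B\<^sub>3 * ?d)\<^sup>2"
      using zero_le_power2[of "norm ?g - B\<^sub>3 * ?d"] by (simp add: power2_sum power2_diff)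
    finally show ?thesis by (simp add: power_mult_distrib)
  qed
  have "(\<Sum>S\<in>UNIV. w S * (F (Y (\<theta>' S)) - Fmin + \<kappa> * ?D S))
      = (\<Sum>S\<in>UNIV. w S * (F (Y (\<theta>' S)) + \<kappa> * ?D S)) - (\<Sum>S\<in>UNIV. w S) * Fmin"
    unfolding sum_distrib_right sum_subtractf[symmetric] by (rule sum.cong) (auto simp: algebra_simps)
  also have "\<dots> \<le> F (Y \<theta>) - Fmin + (- \<eta> * q * (?J ?g \<bullet> ?J p) + c\<^sub>2 * \<eta>\<^sup>2 * q * (norm p)\<^sup>2
      + \<kappa> * (m * ?d\<^sup>2 + \<eta>\<^sup>2 * B\<^sub>1 ^ 4 * q / (1 - m) * (norm p)\<^sup>2))"
    using expected_one_step[OF \<theta> m q \<kappa>0 w next_in, of c] unfolding \<theta>'_def w(2) c\<^sub>2 by simp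
  also have "\<dots> \<le> F (Y \<theta>) - Fmin + (- ?\<delta> * (norm ?g)\<^sup>2 + (1 - 3/8 * (1 - m)) * (\<kappa> * ?d\<^sup>2))"
    using lyapunov_coefficients[OF m q \<nu> step c\<^sub>20 \<eta> c\<^sub>5 coercive x p \<kappa>] by simp
  also have "\<dots> \<le> F (Y \<theta>) - Fmin + (- ?\<delta> * (2 * c\<^sub>Y * (F (Y \<theta>) - Fmin)) + (1 - 3/8 * (1 - m)) * (\<kappa> * ?d\<^sup>2))"
    using mult_left_mono[OF convex \<delta>0] by simp
  also have "\<dots> = (1 - 2 * c\<^sub>Y * ?\<delta>) * (F (Y \<theta>) - Fmin) + (1 - 3/8 * (1 - m)) * (\<kappa> * ?d\<^sup>2)"
    by (simp add: algebra_simps)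
  also have "\<dots> \<le> max (1 - 2 * c\<^sub>Y * ?\<delta>) (1 - 3/8 * (1 - m)) * (F (Y \<theta>) - Fmin)
      + max (1 - 2 * c\<^sub>Y * ?\<delta>) (1 - 3/8 * (1 - m)) * (\<kappa> * ?d\<^sup>2)"
    using Fmin[of "Y \<theta>"] \<kappa>0 by (intro add_mono mult_right_mono) auto
  finally show ?thesis by (simp add: distrib_left)
qed

text \<open>\<open>\<eta>1\<close> keeps \<open>\<nu>\<close> below 1, \<open>\<eta>2\<close> makes
  the drift small against the contraction gap, and \<open>\<eta>3\<close> leaves a net
  decrease.\<close>

lemma step_size_consequences:
  fixes N \<mu> c\<^sub>2 c\<^sub>4 \<nu> c\<^sub>5 \<eta> B\<^sub>1 B\<^sub>3 lam b :: real
  assumes b: "0 < b" "b < N" and \<mu>: "\<mu> = sqrt (1 - b / N)"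
    and pos: "0 < B\<^sub>1" "0 < B\<^sub>3" "0 < lam" "0 < c\<^sub>2" "0 < c\<^sub>4" "0 < \<eta>"
    and \<nu>: "\<nu> = \<mu> / (1 - c\<^sub>4 * \<eta>)"
    and c\<^sub>5: "c\<^sub>5 = 4 * c\<^sub>2 + b / (2 * N) * B\<^sub>1^4
                   + (2 * b * B\<^sub>1^4 * B\<^sub>3^2) / (N * \<mu> * (1 - \<mu>) * (1 - \<nu>))"
    and \<eta>1: "\<eta> < 1 / c\<^sub>4 * (b / (2 * N))"
    and \<eta>2: "\<eta> < sqrt (2 * \<mu> * (1 - \<mu>)) * b / (8 * B\<^sub>1^2 * B\<^sub>3 * (2 * N - b))"
    and \<eta>3: "\<eta> < b / (c\<^sub>5 * N) * lam"
  defines "q \<equiv> b / N"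
  shows "0 < \<mu>" "\<mu> < 1" "q = 1 - \<mu>\<^sup>2" "\<mu> \<le> \<nu>" "\<nu> < 1"
    "16 * q * (\<eta>\<^sup>2 * B\<^sub>1 ^ 4 * B\<^sub>3\<^sup>2) \<le> (1 - \<mu>)\<^sup>2"
    "c\<^sub>5 = 4 * c\<^sub>2 + q / 2 * B\<^sub>1 ^ 4 + 2 * q * B\<^sub>1 ^ 4 * B\<^sub>3\<^sup>2 / (\<mu> * (1 - \<mu>) * (1 - \<nu>))"
    "\<eta> * c\<^sub>5 < q * lam"
proof -
  have q01: "0 < q" "q < 1" using b by (auto simp: q_def)
  show \<mu>0: "0 < \<mu>" and \<mu>1: "\<mu> < 1" using q01 by (auto simp: \<mu> q_def[symmetric] real_sqrt_lt_1_iff)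
  show q: "q = 1 - \<mu>\<^sup>2" using q01 by (simp add: \<mu> q_def[symmetric])
  have N0: "0 < N" using b by linarith
  have c\<^sub>4\<eta>: "c\<^sub>4 * \<eta> < q / 2" using \<eta>1 pos N0 by (simp add: q_def field_simps)
  \<comment> \<open>With \<open>q = 1 - \<mu>\<^sup>2\<close>, the number \<open>1 - q / 2\<close>
    is the mean of 1 and \<open>\<mu>\<^sup>2\<close>, which exceeds \<open>\<mu>\<close>.\<close>
  have "0 < (1 - \<mu>)\<^sup>2" using \<mu>1 by simp
  then have "\<mu> < 1 - q / 2" by (simp add: q power2_eq_square field_simps)
  then have lt: "\<mu> < 1 - c\<^sub>4 * \<eta>" using c\<^sub>4\<eta> by linarith
  then show \<nu>1: "\<nu> < 1" using \<mu>0 by (simp add: \<nu>)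
  have "0 < c\<^sub>4 * \<eta>" using pos by simp
  then show "\<mu> \<le> \<nu>" using lt \<mu>0 by (simp add: \<nu> le_divide_eq)
  have X0: "0 < 8 * B\<^sub>1\<^sup>2 * B\<^sub>3 * (2 - q)" using pos q01 by simp
  have "sqrt (2 * \<mu> * (1 - \<mu>)) * b / (8 * B\<^sub>1^2 * B\<^sub>3 * (2 * N - b))
      = sqrt (2 * \<mu> * (1 - \<mu>)) * q / (8 * B\<^sub>1\<^sup>2 * B\<^sub>3 * (2 - q))"
  proof -
    have "2 * N - b = N * (2 - q)" "b = N * q" using N0 by (simp_all add: q_def algebra_simps)
    then show ?thesis using N0 by (simp add: mult_ac)
  qed
  with \<eta>2 have "\<eta> * (8 * B\<^sub>1\<^sup>2 * B\<^sub>3 * (2 - q)) < sqrt (2 * \<mu> * (1 - \<mu>)) * q"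
    using X0 by (simp add: pos_less_divide_eq)
  moreover have "\<eta> * (8 * B\<^sub>1\<^sup>2 * B\<^sub>3) * 1 \<le> \<eta> * (8 * B\<^sub>1\<^sup>2 * B\<^sub>3) * (2 - q)"
    using pos q01 by (intro mult_left_mono) auto
  ultimately have "\<eta> * (8 * B\<^sub>1\<^sup>2 * B\<^sub>3) \<le> sqrt (2 * \<mu> * (1 - \<mu>)) * q"
    by (simp add: mult_ac)
  then have "(\<eta> * (8 * B\<^sub>1\<^sup>2 * B\<^sub>3))\<^sup>2 \<le> (sqrt (2 * \<mu> * (1 - \<mu>)) * q)\<^sup>2"
    using pos by (intro power_mono) auto
  also have "\<dots> = 2 * \<mu> * (1 - \<mu>) * q\<^sup>2" using \<mu>0 \<mu>1 by (simp add: power_mult_distrib)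
  finally have "32 * (\<eta>\<^sup>2 * B\<^sub>1 ^ 4 * B\<^sub>3\<^sup>2) \<le> \<mu> * (1 - \<mu>) * q\<^sup>2"
    by (simp add: power_mult_distrib algebra_simps)
  then have "q / 2 * (32 * (\<eta>\<^sup>2 * B\<^sub>1 ^ 4 * B\<^sub>3\<^sup>2)) \<le> q / 2 * (\<mu> * (1 - \<mu>) * q\<^sup>2)"
    using q01 by (intro mult_left_mono) auto
  \<comment> \<open>One of the three factors \<open>q\<close> is written as
    \<open>(1 - \<mu>) * (1 + \<mu>)\<close> to gain the second factor
    \<open>1 - \<mu>\<close>.\<close>
  also have "\<dots> = (1 - \<mu>)\<^sup>2 * (\<mu> * (1 + \<mu>) / 2 * q\<^sup>2)"
  proof -
    have "q = (1 - \<mu>) * (1 + \<mu>)" by (simp add: q power2_eq_square algebra_simps)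
    then have "q / 2 * (\<mu> * (1 - \<mu>) * q\<^sup>2) = (1 - \<mu>) * (1 + \<mu>) / 2 * (\<mu> * (1 - \<mu>) * q\<^sup>2)" by simp
    then show ?thesis by (simp add: power2_eq_square mult_ac)
  qed
  also have "\<dots> \<le> (1 - \<mu>)\<^sup>2 * 1"
  proof (intro mult_left_mono mult_le_one)
    have "\<mu> * (1 + \<mu>) \<le> 1 * 2" using \<mu>0 \<mu>1 by (intro mult_mono) auto
    then show "\<mu> * (1 + \<mu>) / 2 \<le> 1" by simp
    show "q\<^sup>2 \<le> 1" using q01 by (simp add: power_le_one)
  qed auto
  finally show "16 * q * (\<eta>\<^sup>2 * B\<^sub>1 ^ 4 * B\<^sub>3\<^sup>2) \<le> (1 - \<mu>)\<^sup>2" by (simp add: mult_ac)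
  show c\<^sub>5': "c\<^sub>5 = 4 * c\<^sub>2 + q / 2 * B\<^sub>1 ^ 4 + 2 * q * B\<^sub>1 ^ 4 * B\<^sub>3\<^sup>2 / (\<mu> * (1 - \<mu>) * (1 - \<nu>))"
    by (simp add: c\<^sub>5 q_def mult_ac)
  \<comment> \<open>The sign permits clearing the denominator in \<open>\<eta>3\<close>.\<close>
  have "0 < c\<^sub>5"
    unfolding c\<^sub>5' using pos q01 \<mu>0 \<mu>1 \<nu>1 by (intro add_pos_nonneg) auto
  then show "\<eta> * c\<^sub>5 < q * lam" using \<eta>3 N0 by (simp add: q_def field_simps)
qed

subsection \<open>Expectation over batch histories\<close>

lemma csg_state_cong:
  assumes "\<And>j. j < k \<Longrightarrow> \<B> j = \<B>' j"
  shows "csg_state Y G \<eta> \<theta>\<^sub>0 \<B> k = csg_state Y G \<eta> \<theta>\<^sub>0 \<B>' k"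
  using assms by (induction k) auto

definition history :: "(nat \<Rightarrow> 'w \<Rightarrow> 'b) \<Rightarrow> nat \<Rightarrow> 'w \<Rightarrow> 'b list" where
  "history \<B> k \<omega> = map (\<lambda>j. \<B> j \<omega>) [0..<k]"

lemma length_history [simp]: "length (history \<B> k \<omega>) = k"
  by (simp add: history_def)

lemma history_eq_iff: "length h = k \<Longrightarrow> history \<B> k \<omega> = h \<longleftrightarrow> (\<forall>j<k. \<B> j \<omega> = h ! j)"
  by (auto simp: history_def list_eq_iff_nth_eq)

text \<open>Makes the state a function of a finite list. Indexing past the end of the list is
  harmless, since \<open>k\<close> steps read only the first \<open>k\<close> entries.\<close>

lemma csg_state_history:
  "csg_state Y G \<eta> \<theta>\<^sub>0 (\<lambda>j. \<B> j \<omega>) k = csg_state Y G \<eta> \<theta>\<^sub>0 ((!) (history \<B> k \<omega>)) k"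
  by (rule csg_state_cong) (simp add: history_def)

lemma csg_state_append:
  "csg_state Y G \<eta> \<theta>\<^sub>0 ((!) (h @ h')) (length h) = csg_state Y G \<eta> \<theta>\<^sub>0 ((!) h) (length h)"
  by (rule csg_state_cong) (simp add: nth_append)

context prob_space
begin

lemma indep_vars_history_event:
  fixes \<B> :: "nat \<Rightarrow> 'a \<Rightarrow> 'b"
  assumes "indep_vars (\<lambda>_. count_space UNIV) \<B> UNIV" and "length h = k"
  shows "{\<omega> \<in> space M. history \<B> k \<omega> = h} \<in> events"
    and "prob {\<omega> \<in> space M. history \<B> k \<omega> = h} = (\<Prod>j<k. prob {\<omega> \<in> space M. \<B> j \<omega> = h ! j})"
proof -
  have rv: "\<B> j \<in> measurable M (count_space UNIV)" for j
    using assms(1) by (simp add: indep_vars_def)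
  have ev: "{\<omega> \<in> space M. \<B> j \<omega> = x} \<in> events" for j x
    using measurable_sets[OF rv, of "{x}" j] by (simp add: vimage_def Int_def conj_commute)
  have *: "{\<omega> \<in> space M. history \<B> k \<omega> = h} = space M \<inter> (\<Inter>j<k. {\<omega> \<in> space M. \<B> j \<omega> = h ! j})"
    using assms(2) by (auto simp: history_eq_iff)
  show "{\<omega> \<in> space M. history \<B> k \<omega> = h} \<in> events"
  \<comment> \<open>An empty intersection is \<open>UNIV\<close>, not \<open>space M\<close>, and
    \<open>indep_setsD\<close> below asks for a nonempty index set.\<close>
  proof (cases "k = 0")
    case False
    then have "(\<Inter>j<k. {\<omega> \<in> space M. \<B> j \<omega> = h ! j}) \<in> events"
      by (intro sets.finite_INT) (auto simp: ev)
    then show ?thesis unfolding * by blast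
  qed (use assms(2) in \<open>simp add: history_def\<close>)
  have ind: "indep_sets (\<lambda>j. {\<B> j -` A \<inter> space M | A. A \<in> sets (count_space UNIV)}) UNIV"
    using assms(1) by (simp add: indep_vars_def2)
  show "prob {\<omega> \<in> space M. history \<B> k \<omega> = h} = (\<Prod>j<k. prob {\<omega> \<in> space M. \<B> j \<omega> = h ! j})"
  proof (cases "k = 0")
    case True
    then show ?thesis using assms(2) by (simp add: history_def prob_space)
  next
    case False
    then have "space M \<inter> (\<Inter>j<k. {\<omega> \<in> space M. \<B> j \<omega> = h ! j}) = (\<Inter>j<k. {\<omega> \<in> space M. \<B> j \<omega> = h ! j})"
      by auto
    moreover have "prob (\<Inter>j\<in>{..<k}. {\<omega> \<in> space M. \<B> j \<omega> = h ! j})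
        = (\<Prod>j\<in>{..<k}. prob {\<omega> \<in> space M. \<B> j \<omega> = h ! j})"
    proof (rule indep_setsD[OF ind])
      have "\<exists>A. {\<omega> \<in> space M. \<B> j \<omega> = h ! j} = \<B> j -` A \<inter> space M" for j
        by (rule exI[of _ "{h ! j}"]) auto
      then show "\<forall>j\<in>{..<k}. {\<omega> \<in> space M. \<B> j \<omega> = h ! j} \<in> {\<B> j -` A \<inter> space M | A. A \<in> sets (count_space UNIV)}"
        by simp
    qed (use False in auto)
    ultimately show ?thesis by (simp add: * )
  qed
qed

text \<open>The form in which independence of the past is used: the weight of the next batch does
  not depend on \<open>h\<close>.\<close>

lemma prob_history_snoc:
  assumes "indep_vars (\<lambda>_. count_space UNIV) \<B> UNIV" and "length h = k"
  shows "prob {\<omega> \<in> space M. history \<B> (Suc k) \<omega> = h @ [S]}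
       = prob {\<omega> \<in> space M. history \<B> k \<omega> = h} * prob {\<omega> \<in> space M. \<B> k \<omega> = S}"
  using assms by (simp add: indep_vars_history_event(2) nth_append)

lemma expectation_finite_range:
  fixes X :: "'a \<Rightarrow> 'b" and \<phi> :: "'b \<Rightarrow> real"
  assumes fin: "finite A" and range: "\<And>\<omega>. X \<omega> \<in> A"
    and ev: "\<And>x. x \<in> A \<Longrightarrow> {\<omega> \<in> space M. X \<omega> = x} \<in> events"
  shows "(LINT \<omega>|M. \<phi> (X \<omega>)) = (\<Sum>x\<in>A. prob {\<omega> \<in> space M. X \<omega> = x} * \<phi> x)"
proof -
  have "(LINT \<omega>|M. \<phi> (X \<omega>)) = (LINT \<omega>|M. (\<Sum>x\<in>A. indicator {\<omega> \<in> space M. X \<omega> = x} \<omega> * \<phi> x))"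
  proof (rule Bochner_Integration.integral_cong[OF refl])
    fix \<omega> assume \<omega>: "\<omega> \<in> space M"
    have "(\<Sum>x\<in>A. indicator {\<omega> \<in> space M. X \<omega> = x} \<omega> * \<phi> x) = (\<Sum>x\<in>A. if x = X \<omega> then \<phi> x else 0)"
      by (rule sum.cong) (auto simp: indicator_def \<omega>)
    also have "\<dots> = \<phi> (X \<omega>)" using fin range by simp
    finally show "\<phi> (X \<omega>) = (\<Sum>x\<in>A. indicator {\<omega> \<in> space M. X \<omega> = x} \<omega> * \<phi> x)" by simp
  qed
  also have "\<dots> = (\<Sum>x\<in>A. prob {\<omega> \<in> space M. X \<omega> = x} * \<phi> x)"
    using ev
    by (subst Bochner_Integration.integral_sum)
       (auto intro!: integrable_mult_left integrable_real_indicator simp: emeasure_eq_measure Int_absorb1 Int_absorb2 subset_eq)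
  finally show ?thesis .
qed

lemma expectation_history:
  fixes \<B> :: "nat \<Rightarrow> 'a \<Rightarrow> 'b::finite" and \<phi> :: "'b list \<Rightarrow> real"
  assumes "indep_vars (\<lambda>_. count_space UNIV) \<B> UNIV"
  shows "(LINT \<omega>|M. \<phi> (history \<B> k \<omega>))
       = (\<Sum>h | length h = k. prob {\<omega> \<in> space M. history \<B> k \<omega> = h} * \<phi> h)"
  using finite_lists_length_eq[of "UNIV :: 'b set" k] indep_vars_history_event(1)[OF assms]
  by (intro expectation_finite_range) auto

lemma AE_history:
  assumes ind: "indep_vars (\<lambda>_. count_space UNIV) \<B> UNIV"
    and AE: "AE \<omega> in M. P (history \<B> k \<omega>)"
    and h: "length h = k" "prob {\<omega> \<in> space M. history \<B> k \<omega> = h} \<noteq> 0"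
  shows "P h"
proof (rule ccontr)
  assume "\<not> P h"
  then have "AE \<omega> in M. history \<B> k \<omega> \<noteq> h" using AE by (auto elim!: AE_mp)
  then have "prob {\<omega> \<in> space M. history \<B> k \<omega> = h} = 0"
    using indep_vars_history_event(1)[OF ind h(1)]
    by (subst prob_eq_0) auto
  then show False using h by simp
qed

end

lemma sum_lists_Suc:
  fixes g :: "'b::finite list \<Rightarrow> real"
  shows "(\<Sum>h | length h = Suc k. g h) = (\<Sum>h | length h = k. \<Sum>S\<in>UNIV. g (h @ [S]))"
proof -
  have "(\<Sum>h | length h = k. \<Sum>S\<in>UNIV. g (h @ [S])) = (\<Sum>(h, S)\<in>{h. length h = k} \<times> UNIV. g (h @ [S]))"
    by (rule sum.cartesian_product)
  also have "\<dots> = (\<Sum>h | length h = Suc k. g h)"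
    by (rule sum.reindex_bij_witness[of _ "\<lambda>h. (butlast h, last h)" "\<lambda>(h, S). h @ [S]"])
       (auto simp: append_butlast_last_id length_Suc_conv_rev)
  finally show ?thesis by simp
qed

subsection \<open>Linear convergence\<close>

theorem theorem4p7:
  fixes Y :: "real^'s \<Rightarrow> real^'d^'n"
    and F :: "real^'d^'n \<Rightarrow> real"
    and G :: "real^'d^'n \<Rightarrow> real^'d^'n \<Rightarrow> real^'d^'n"
    and M :: "'w measure"
    and \<B> :: "nat \<Rightarrow> 'w \<Rightarrow> 'n set"
    and b :: nat
    and \<theta>\<^sub>0 :: "real^'s"
    and \<Omega> :: "(real^'s) set"
    and V :: "(real^'d^'n) set"
    and Ystar :: "real^'d^'n"
    and r \<eta> B\<^sub>0 L B\<^sub>1 B\<^sub>2 lambda_min B\<^sub>3 c\<^sub>Y N \<mu> c\<^sub>2 c\<^sub>4 \<nu> c\<^sub>5 :: real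
  assumes Y_C2: "C2_map Y"
    and F_C1: "C1_map F"
    and G_C1: "\<And>y. C1_map (\<lambda>u. G u y)"
    and G_diag: "\<And>y. G y y = gradient F y"
    and b: "1 \<le> b" "b < CARD('n)"
    and batches: "random_batches M b \<B>"
    and \<Omega>: "open \<Omega>" "convex \<Omega>"
    and V: "r > 0" "V = ball Ystar r"
    and Y_maps: "Y ` \<Omega> \<subseteq> V"
    and pos: "B\<^sub>0 > 0" "L > 0" "B\<^sub>1 > 0" "B\<^sub>2 > 0" "lambda_min > 0" "B\<^sub>3 > 0"
    and A1: "\<And>y. y \<in> V \<Longrightarrow> norm (gradient F y) \<le> B\<^sub>0"
    and A2: "\<And>y y'. y \<in> V \<Longrightarrow> y' \<in> V \<Longrightarrow>
               norm (gradient F y - gradient F y') \<le> L * norm (y - y')"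
    and A3: "\<And>\<theta>. \<theta> \<in> \<Omega> \<Longrightarrow> norm (full_jacobian Y \<theta>) \<le> B\<^sub>1"
    and A4: "\<And>\<theta>. \<theta> \<in> \<Omega> \<Longrightarrow> norm (second_derivative Y \<theta>) \<le> B\<^sub>2"
    and A5: "\<And>\<theta>. \<theta> \<in> \<Omega> \<Longrightarrow>
               smallest_eigenvalue (full_jacobian Y \<theta> ** transpose (full_jacobian Y \<theta>)) \<ge> lambda_min"
    and A6: "AE \<omega> in M. \<forall>k. \<forall>t\<in>{0..1}. \<forall>\<Delta>.
               let y = Y (csg_param Y G \<eta> \<theta>\<^sub>0 (\<lambda>j. \<B> j \<omega>) k);
                   c = csg_cache Y G \<eta> \<theta>\<^sub>0 (\<lambda>j. \<B> j \<omega>) k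
               in norm (frechet_derivative (\<lambda>u. G u y) (at (y + t *\<^sub>R (c - y))) \<Delta>)
                    \<le> B\<^sub>3 * norm \<Delta>"
    and iterates: "AE \<omega> in M. \<forall>k. csg_param Y G \<eta> \<theta>\<^sub>0 (\<lambda>j. \<B> j \<omega>) k \<in> \<Omega>"
    and convex_F: "c\<^sub>Y > 0" "strongly_convex_on V F c\<^sub>Y"
    and minimum: "\<And>y. F Ystar \<le> F y"
    and N: "N = real CARD('n)"
    and \<mu>: "\<mu> = sqrt (1 - b / N)"
    and c\<^sub>2: "c\<^sub>2 = 1/2 * (L * B\<^sub>1^2 + B\<^sub>0 * B\<^sub>2) * B\<^sub>1^2"
    and c\<^sub>4: "c\<^sub>4 = 4 * B\<^sub>1^2 * L * (1 + B\<^sub>1^2 * L)"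
    and \<nu>: "\<nu> = \<mu> / (1 - c\<^sub>4 * \<eta>)"
    and c\<^sub>5: "c\<^sub>5 = 4 * c\<^sub>2 + b / (2 * N) * B\<^sub>1^4
                   + (2 * real b * B\<^sub>1^4 * B\<^sub>3^2) / (N * \<mu> * (1 - \<mu>) * (1 - \<nu>))"
    and \<eta>_pos: "\<eta> > 0"
    and \<eta>_less: "\<eta> < Min {1 / c\<^sub>4 * (b / (2 * N)),
                        sqrt (2 * \<mu> * (1 - \<mu>)) * b / (8 * B\<^sub>1^2 * B\<^sub>3 * (2 * N - b)),
                        1,
                        b / (c\<^sub>5 * N) * lambda_min}"
  shows "\<exists>C \<rho>. C > 0 \<and> 0 < \<rho> \<and> \<rho> < 1 \<and>
           (\<forall>k. (LINT \<omega>|M. F (Y (csg_param Y G \<eta> \<theta>\<^sub>0 (\<lambda>j. \<B> j \<omega>) k))) - F Ystar \<le> C * \<rho> ^ k)"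
proof -
  interpret prob_space M using batches by (simp add: random_batches_def)
  have ind: "indep_vars (\<lambda>_. count_space UNIV) \<B> UNIV"
    and incl: "\<And>k n. prob {\<omega> \<in> space M. n \<in> \<B> k \<omega>} = real b / real CARD('n)"
    using batches by (simp_all add: random_batches_def)
  interpret surrogate_region Y F \<Omega> V B\<^sub>0 L B\<^sub>1 B\<^sub>2
    using Y_C2 F_C1 \<Omega> Y_maps pos A1 A2 A3 A4 by unfold_locales (auto intro: less_imp_le)
  define q where "q = b / N"
  have bN: "0 < real b" "real b < N" using b by (auto simp: N)
  have c20: "0 < c\<^sub>2" using pos by (simp add: c\<^sub>2 add_pos_pos)
  have c40: "0 < c\<^sub>4" using pos by (simp add: c\<^sub>4 add_pos_pos)
  have \<eta>_bounds: "\<eta> < 1 / c\<^sub>4 * (b / (2 * N))"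
    "\<eta> < sqrt (2 * \<mu> * (1 - \<mu>)) * b / (8 * B\<^sub>1^2 * B\<^sub>3 * (2 * N - b))"
    "\<eta> < b / (c\<^sub>5 * N) * lambda_min"
    using \<eta>_less by auto
  note sc = step_size_consequences[OF bN \<mu> pos(3,6,5) c20 c40 \<eta>_pos \<nu> c\<^sub>5 \<eta>_bounds, folded q_def]
  define \<kappa> where "\<kappa> = q * B\<^sub>3\<^sup>2 * (1 + 4 * c\<^sub>2 * \<eta>\<^sup>2) / (1 - \<mu>)"
  define \<rho> where "\<rho> = max (1 - 2 * c\<^sub>Y * (\<eta> * (q * lambda_min - \<eta> * c\<^sub>5))) (1 - 3/8 * (1 - \<mu>))"
  \<comment> \<open>The second entry of the maximum exceeds 5/8, so \<open>\<rho>\<close> is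
    positive even if the first is not; the strict bound \<open>sc(8)\<close> keeps the first below
    1.\<close>
  have \<rho>: "0 < \<rho>" "\<rho> < 1"
    using sc(1,2,8) \<eta>_pos convex_F(1) by (auto simp: \<rho>_def less_max_iff_disj)
  have \<kappa>0: "0 \<le> \<kappa>" using bN c20 sc(2) by (simp add: \<kappa>_def q_def)
  define state where "state h k = csg_state Y G \<eta> \<theta>\<^sub>0 ((!) h) k" for h :: "'n set list" and k
  define W where "W s = F (Y (fst s)) - F Ystar + \<kappa> * (norm (snd s - Y (fst s)))\<^sup>2"
    for s :: "(real^'s) \<times> (real^'d^'n)"
  define P where "P h = prob {\<omega> \<in> space M. history \<B> (length h) \<omega> = h}" for h
  define w where "w k S = prob {\<omega> \<in> space M. \<B> k \<omega> = S}" for k S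
  have P_snoc: "P (h @ [S]) = P h * w (length h) S" for h S
    unfolding P_def w_def using prob_history_snoc[OF ind refl] by simp
  have state_snoc: "state (h @ [S]) (Suc (length h)) =
      (let \<theta>' = fst (state h (length h)) - \<eta> *\<^sub>R output_adjoint Y (fst (state h (length h)))
             (mask S (G (snd (state h (length h))) (Y (fst (state h (length h))))))
       in (\<theta>', \<chi> n. if n \<in> S then Y \<theta>' $ n else snd (state h (length h)) $ n))" for h S
    unfolding state_def
    by (simp add: csg_state_append batch_gradient_eq_output_adjoint mask_def Let_def case_prod_beta)
  have B_meas: "\<B> k \<in> measurable M (count_space UNIV)" for k
    using ind by (simp add: indep_vars_def)
  have B_ev: "{\<omega> \<in> space M. \<B> k \<omega> = S} \<in> events" for k S
    using measurable_sets[OF B_meas, of "{S}" k] by (simp add: vimage_def Int_def conj_commute)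
  have w_sum: "(\<Sum>S\<in>UNIV. w k S * \<phi> S) = (LINT \<omega>|M. \<phi> (\<B> k \<omega>))" for k and \<phi> :: "'n set \<Rightarrow> real"
    unfolding w_def by (rule expectation_finite_range[symmetric]) (auto simp: B_ev)
  have w_one: "(\<Sum>S\<in>UNIV. w k S) = 1" for k
    using w_sum[of k "\<lambda>_. 1"] by (simp add: prob_space)
  have w_incl: "(\<Sum>S\<in>UNIV. w k S * of_bool (n \<in> S)) = q" for k n
  proof -
    have "{\<omega> \<in> space M. n \<in> \<B> k \<omega>} \<in> events"
      using measurable_sets[OF B_meas, of "{S. n \<in> S}" k] by (simp add: vimage_def Int_def conj_commute)
    moreover have "(LINT \<omega>|M. of_bool (n \<in> \<B> k \<omega>)) = (LINT \<omega>|M. indicator {\<omega> \<in> space M. n \<in> \<B> k \<omega>} \<omega> :: real)"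
      by (rule Bochner_Integration.integral_cong) auto
    ultimately show ?thesis by (simp add: w_sum incl q_def N)
  qed
  have in_\<Omega>: "fst (state h (length h)) \<in> \<Omega>" if "P h \<noteq> 0" for h
  proof (rule AE_history[where P = "\<lambda>x. fst (state x (length h)) \<in> \<Omega>", OF ind _ refl])
    show "AE \<omega> in M. fst (state (history \<B> (length h) \<omega>) (length h)) \<in> \<Omega>"
      using iterates by eventually_elim (metis state_def csg_param_def csg_state_history)
  qed (use that in \<open>simp add: P_def\<close>)
  have surrogate: "norm (G (snd (state h (length h))) (Y (fst (state h (length h))))
      - gradient F (Y (fst (state h (length h))))) \<le> B\<^sub>3 * norm (snd (state h (length h)) - Y (fst (state h (length h))))"
    if "P h \<noteq> 0" for h
  proof -
    have "\<forall>t\<in>{0..1}. \<forall>\<Delta>. let y = Y (fst (state h (length h))); c = snd (state h (length h)) in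
        norm (frechet_derivative (\<lambda>u. G u y) (at (y + t *\<^sub>R (c - y))) \<Delta>) \<le> B\<^sub>3 * norm \<Delta>"
    proof (rule AE_history[where P = "\<lambda>x. \<forall>t\<in>{0..1}. \<forall>\<Delta>.
        let y = Y (fst (state x (length h))); c = snd (state x (length h)) in
        norm (frechet_derivative (\<lambda>u. G u y) (at (y + t *\<^sub>R (c - y))) \<Delta>) \<le> B\<^sub>3 * norm \<Delta>", OF ind _ refl])
      show "AE \<omega> in M. \<forall>t\<in>{0..1}. \<forall>\<Delta>.
          let y = Y (fst (state (history \<B> (length h) \<omega>) (length h)));
              c = snd (state (history \<B> (length h) \<omega>) (length h)) in
          norm (frechet_derivative (\<lambda>u. G u y) (at (y + t *\<^sub>R (c - y))) \<Delta>) \<le> B\<^sub>3 * norm \<Delta>"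
        using A6
      proof eventually_elim
        case (elim \<omega>)
        then show ?case
          unfolding csg_param_def csg_cache_def csg_state_history[of _ _ _ _ \<B> \<omega>] state_def by blast
      qed
    qed (use that in \<open>simp add: P_def\<close>)
    then show ?thesis
      using norm_diff_le_of_frechet_derivative_bound[OF G_C1] unfolding G_diag[symmetric] Let_def by blast
  qed
  have step: "(\<Sum>S\<in>UNIV. w (length h) S * W (state (h @ [S]) (Suc (length h)))) \<le> \<rho> * W (state h (length h))"
    if Ph: "P h \<noteq> 0" for h
  proof -
    let ?\<theta> = "fst (state h (length h))" and ?c = "snd (state h (length h))"
    let ?p = "G ?c (Y ?\<theta>)"
    \<comment> \<open>A batch of positive weight extends \<open>h\<close> to a history of positive
      probability, so the almost sure inclusion applies to the longer history.\<close>
    have next_in: "?\<theta> - \<eta> *\<^sub>R output_adjoint Y ?\<theta> (mask S ?p) \<in> \<Omega>" if "w (length h) S \<noteq> 0" for S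
      using in_\<Omega>[of "h @ [S]"] Ph that P_snoc[of h S] state_snoc[of h S] by (simp add: Let_def)
    have coercive: "lambda_min * (norm v)\<^sup>2 \<le> (norm (output_adjoint Y ?\<theta> v))\<^sup>2" for v
      by (rule order_trans[OF mult_right_mono[OF A5[OF in_\<Omega>[OF Ph]] zero_le_power2]
            smallest_eigenvalue_le_output_adjoint])
    \<comment> \<open>\<open>Ystar\<close> lies in \<open>V\<close> as the centre of a ball of
      positive radius, so it is an admissible comparison point.\<close>
    have convex: "2 * c\<^sub>Y * (F (Y ?\<theta>) - F Ystar) \<le> (norm (gradient F (Y ?\<theta>)))\<^sup>2"
      by (rule strongly_convex_on_gradient_bound[OF convex_F(2,1)])
         (use Y_maps in_\<Omega>[OF Ph] V in auto)
    show ?thesis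
      using lyapunov_contraction[OF in_\<Omega>[OF Ph] sc(1-6) \<eta>_pos c\<^sub>2 sc(7) less_imp_le[OF sc(8)]
          \<kappa>_def less_imp_le[OF pos(6)] _ w_one w_incl next_in coercive surrogate[OF Ph] convex minimum]
      by (simp add: state_snoc W_def Let_def \<rho>_def w_def)
  qed
  \<comment> \<open>The expectation of \<open>W\<close> as a finite sum; conditioning on the past
    becomes splitting off the last list entry.\<close>
  define E where "E k = (\<Sum>h | length h = k. P h * W (state h k))" for k
  have E_Suc: "E (Suc k) \<le> \<rho> * E k" for k
  proof -
    have "E (Suc k) = (\<Sum>h | length h = k. P h * (\<Sum>S\<in>UNIV. w k S * W (state (h @ [S]) (Suc k))))"
      unfolding E_def sum_lists_Suc sum_distrib_left by (intro sum.cong refl) (auto simp: P_snoc)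
    also have "\<dots> \<le> (\<Sum>h | length h = k. P h * (\<rho> * W (state h k)))"
    proof (rule sum_mono)
      fix h :: "'n set list" assume "h \<in> {h. length h = k}"
      then show "P h * (\<Sum>S\<in>UNIV. w k S * W (state (h @ [S]) (Suc k))) \<le> P h * (\<rho> * W (state h k))"
        using step[of h] by (cases "P h = 0") (auto intro!: mult_left_mono simp: P_def)
    qed
    also have "\<dots> = \<rho> * E k" by (simp add: E_def sum_distrib_left mult_ac)
    finally show ?thesis .
  qed
  have E_le: "E k \<le> E 0 * \<rho> ^ k" for k
  proof (induction k)
    case (Suc k)
    have "E (Suc k) \<le> \<rho> * (E 0 * \<rho> ^ k)"
      using E_Suc[of k] mult_left_mono[OF Suc.IH less_imp_le[OF \<rho>(1)]] by linarith
    then show ?case by (simp add: mult_ac)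
  qed simp
  have loss_le: "(LINT \<omega>|M. F (Y (csg_param Y G \<eta> \<theta>\<^sub>0 (\<lambda>j. \<B> j \<omega>) k))) - F Ystar \<le> E k" for k
  proof -
    have expectation: "(LINT \<omega>|M. \<phi> (history \<B> k \<omega>)) = (\<Sum>h | length h = k. P h * \<phi> h)" for \<phi> :: "'n set list \<Rightarrow> real"
      unfolding expectation_history[OF ind] by (rule sum.cong) (auto simp: P_def)
    have "(\<Sum>h | length h = k. P h) = 1"
      using expectation[of "\<lambda>_. 1"] by (simp add: prob_space)
    moreover have "(LINT \<omega>|M. F (Y (csg_param Y G \<eta> \<theta>\<^sub>0 (\<lambda>j. \<B> j \<omega>) k)))
        = (\<Sum>h | length h = k. P h * F (Y (fst (state h k))))"
      unfolding csg_param_def csg_state_history[of _ _ _ _ \<B>] state_def[symmetric] by (rule expectation)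
    ultimately have "(LINT \<omega>|M. F (Y (csg_param Y G \<eta> \<theta>\<^sub>0 (\<lambda>j. \<B> j \<omega>) k))) - F Ystar
        = (\<Sum>h | length h = k. P h * (F (Y (fst (state h k))) - F Ystar))"
      by (simp add: right_diff_distrib sum_subtractf sum_distrib_right[symmetric])
    also have "\<dots> \<le> E k"
      unfolding E_def by (intro sum_mono mult_left_mono) (auto simp: W_def P_def \<kappa>0)
    finally show ?thesis .
  qed
  have E0: "0 \<le> E 0"
    unfolding E_def by (intro sum_nonneg mult_nonneg_nonneg) (auto simp: W_def P_def \<kappa>0 minimum)
  show ?thesis
  proof (intro exI conjI allI)
    \<comment> \<open>\<open>E 0\<close> vanishes if the start is already optimal, whereas
      \<open>C\<close> has to be positive.\<close>
    show "0 < E 0 + 1" using E0 by simp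
    show "0 < \<rho>" "\<rho> < 1" by (rule \<rho>)+
    fix k
    have "E k \<le> (E 0 + 1) * \<rho> ^ k" using E_le[of k] \<rho>(1) by (simp add: distrib_right add_increasing2)
    then show "(LINT \<omega>|M. F (Y (csg_param Y G \<eta> \<theta>\<^sub>0 (\<lambda>j. \<B> j \<omega>) k))) - F Ystar \<le> (E 0 + 1) * \<rho> ^ k"
      using loss_le[of k] by linarith
  qed
qed

end
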